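(* The composition product $\circ\colon \mathbb{K}^m_{LC}\langle\langle X\rangle\rangle\times\mathbb{K}^m_{LC}\langle\langle X\rangle\rangle\to\mathbb{K}^m_{LC}\langle\langle X\rangle\rangle$ is continuous with respect to the Silva topology.
   Context: $\mathbb{K}\in\{\mathbb{R},\mathbb{C}\}$. $X=\{x_0,x_1,\ldots,x_m\}$ is a finite alphabet, $X^\ast$ its set of words (including the empty word $\emptyset$), $|\eta|$ the length. $\mathbb{K}^m\langle\langle X\rangle\rangle$ is the set of maps $X^\ast\to\mathbb{K}^m$. For $M>0$, $\|c\|_{\ell_\infty,M}=\sup_\eta|(c,\eta)|/(M^{|\eta|}|\eta|!)$ with $|z|=\max_i|z_i|$, and $\ell_{\infty,M}(X^\ast,\mathbb{K}^m)$ is the Banach space of series with finite norm. $\mathbb{K}^m_{LC}\langle\langle X\rangle\rangle=\bigcup_{M>0}\ell_{\infty,M}(X^\ast,\mathbb{K}^m)$ with the Silva topology, i.e. the locally convex inductive limit topology of these Banach spaces. The shuffle product $\sqcup\!\sqcup$ is the bilinear product determined on words by $(x_i\eta)\sqcup\!\sqcup(x_j\xi)=x_i(\eta\sqcup\!\sqcup(x_j\xi))+x_j((x_i\eta)\sqcup\!\sqcup\xi)$, $\eta\sqcup\!\sqcup\emptyset=\emptyset\sqcup\!\sqcup\eta=\eta$. Composition product: for $c,d$ with $d$ having components $d[1],\ldots,d[m]$ and $d[0]:=\mathbf{1}=1\cdot\emptyset$, let $\psi_d(\emptyset)=\mathrm{id}$, $\psi_d(x_i\eta)=\psi_d(x_i)\circ\psi_d(\eta)$,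 $\psi_d(x_i)(e)=x_0(d[i]\sqcup\!\sqcup e)$ for $e\in\mathbb{K}\langle\langle X\rangle\rangle$; then $c\circ d=\sum_{\eta\in X^\ast}(c,\eta)\,\psi_d(\eta)(\mathbf{1})$. *)

theory Defs
  imports "HOL-Analysis.Analysis"
begin

text \<open>
  Alphabet X = {x_0, x_1, ..., x_m}: letters are of type 'm option, where
  None is x_0 and Some i (i :: 'm, 'm a finite type with m elements) is x_i.
  Words are lists of letters (the empty list is the empty word).
  Scalar series: 'm option list => 'k.
  Vector series (in K^m<<X>>): 'm option list => 'm => 'k.
\<close>

type_synonym ('m, 'k) sseries = "'m option list \<Rightarrow> 'k"
type_synonym ('m, 'k) vseries = "'m option list \<Rightarrow> 'm \<Rightarrow> 'k"

fun shuffle_words :: "'a list \<Rightarrow> 'a list \<Rightarrow> 'a list list" where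
  "shuffle_words [] v = [v]"
| "shuffle_words u [] = [u]"
| "shuffle_words (a # u) (b # v) =
     map ((#) a) (shuffle_words u (b # v)) @ map ((#) b) (shuffle_words (a # u) v)"

definition shuffle :: "('m::finite, 'k::comm_ring_1) sseries \<Rightarrow> ('m, 'k) sseries \<Rightarrow> ('m, 'k) sseries" where
  "shuffle c d = (\<lambda>\<nu>. \<Sum>(u, v) \<in> {(u, v). length u + length v = length \<nu>}.
       c u * d v * of_nat (count_list (shuffle_words u v) \<nu>))"

definition one_series :: "('m, 'k::comm_ring_1) sseries" where
  "one_series = (\<lambda>\<nu>. if \<nu> = [] then 1 else 0)"

definition left_x0 :: "('m, 'k::comm_ring_1) sseries \<Rightarrow> ('m, 'k) sseries" where
  "left_x0 e = (\<lambda>\<nu>. case \<nu> of [] \<Rightarrow> 0 | a # \<nu>' \<Rightarrow> (if a = None then e \<nu>' else 0))"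

definition comp_of :: "('m, 'k::comm_ring_1) vseries \<Rightarrow> 'm option \<Rightarrow> ('m, 'k) sseries" where
  "comp_of d a = (case a of None \<Rightarrow> one_series | Some i \<Rightarrow> (\<lambda>\<nu>. d \<nu> i))"

definition psi_letter :: "('m::finite, 'k::comm_ring_1) vseries \<Rightarrow> 'm option \<Rightarrow> ('m, 'k) sseries \<Rightarrow> ('m, 'k) sseries" where
  "psi_letter d a e = left_x0 (shuffle (comp_of d a) e)"

fun psi :: "('m::finite, 'k::comm_ring_1) vseries \<Rightarrow> 'm option list \<Rightarrow> ('m, 'k) sseries \<Rightarrow> ('m, 'k) sseries" where
  "psi d [] e = e"
| "psi d (a # \<eta>) e = psi_letter d a (psi d \<eta> e)"

text \<open>c o d = sum over eta of (c, eta) psi_d(eta)(1), computed coefficientwise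
  (the sum is locally finite; it is taken as an unconditional sum over all words).\<close>
definition composition :: "('m::finite, 'k::{comm_ring_1, real_normed_field}) vseries \<Rightarrow> ('m, 'k) vseries \<Rightarrow> ('m, 'k) vseries" where
  "composition c d = (\<lambda>\<nu> i. \<Sum>\<^sub>\<infinity>\<eta>\<in>UNIV. c \<eta> i * psi d \<eta> one_series \<nu>)"

definition weighted :: "real \<Rightarrow> ('m, 'k::real_normed_field) vseries \<Rightarrow> 'm option list \<times> 'm \<Rightarrow> real" where
  "weighted M c = (\<lambda>(\<eta>, i). norm (c \<eta> i) / (M ^ length \<eta> * fact (length \<eta>)))"

definition ell_inf :: "real \<Rightarrow> ('m, 'k::real_normed_field) vseries set" where
  "ell_inf M = {c. bdd_above (range (weighted M c))}"

definition ell_norm :: "real \<Rightarrow> ('m, 'k::real_normed_field) vseries \<Rightarrow> real" where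
  "ell_norm M c = (SUP p. weighted M c p)"

definition LC :: "('m, 'k::real_normed_field) vseries set" where
  "LC = (\<Union>M\<in>{M. M > 0}. ell_inf M)"

definition absolutely_convex :: "('m, 'k::real_normed_field) vseries set \<Rightarrow> bool" where
  "absolutely_convex U \<longleftrightarrow>
     (\<forall>x\<in>U. \<forall>y\<in>U. \<forall>a b :: 'k. norm a + norm b \<le> 1 \<longrightarrow> (\<lambda>\<eta> i. a * x \<eta> i + b * y \<eta> i) \<in> U)"

text \<open>Basic 0-neighbourhoods of the locally convex inductive limit topology:
  absolutely convex subsets U of LC such that, for every M > 0, U \<inter> ell_inf M is a
  0-neighbourhood in the Banach space ell_inf M (i.e. contains an open norm ball).\<close>
definition silva_zero_nbhd :: "('m, 'k::real_normed_field) vseries set \<Rightarrow> bool" where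
  "silva_zero_nbhd U \<longleftrightarrow> U \<subseteq> LC \<and> absolutely_convex U \<and>
     (\<forall>M>0. \<exists>\<epsilon>>0. {c \<in> ell_inf M. ell_norm M c < \<epsilon>} \<subseteq> U)"

text \<open>The Silva topology on LC: the locally convex inductive limit topology of the
  Banach spaces ell_inf M, M > 0.\<close>
definition silva_topology :: "('m, 'k::real_normed_field) vseries topology" where
  "silva_topology = topology (\<lambda>S. S \<subseteq> LC \<and>
     (\<forall>x\<in>S. \<exists>U. silva_zero_nbhd U \<and> (\<lambda>u. (\<lambda>\<eta> i. x \<eta> i + u \<eta> i)) ` U \<subseteq> S))"

end

theory Submission
  imports Defs
begin

text \<open>
  The Silva topology has the base of zero neighbourhoods
  \<open>W\<^sub>v = {c. \<bar>(c, \<eta>)\<bar> \<le> v(\<bar>\<eta>\<bar>) \<bar>\<eta>\<bar>!}\<close>, where \<open>v\<close> grows faster than every geometric sequence.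
  The coefficient of a composition at a word of length \<open>n\<close> involves only coefficients at words of
  length at most \<open>n\<close>. If \<open>v(l) = \<delta> s(l)^l\<close> with \<open>s\<close> increasing, these are bounded by the geometric
  sequence with ratio \<open>s(n)\<close>, and for such bounds the shuffle products can be estimated explicitly:
  up to constants, the difference of the compositions at length \<open>n\<close> is at most
  \<open>\<delta> (L s(n)\<^sup>2)^n n!\<close>. It lies below a prescribed \<open>v(n) n!\<close> when \<open>s\<close> tends to infinity
  slowly enough and \<open>\<delta>\<close> is small.
\<close>

section \<open>Growth of shuffle products\<close>

lemma finite_words_le: "finite {\<eta> :: 'm::finite option list. length \<eta> \<le> n}"
  using finite_lists_length_le[of "UNIV :: 'm option set" n] by simp

lemma finite_word_pairs: "finite {(u :: 'm::finite option list, v :: 'm option list). length u + length v = n}"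
  by (rule finite_subset[OF _ finite_cartesian_product[OF finite_words_le[of n] finite_words_le[of n]]]) auto

text \<open>Since n + 1 is at most \<open>2 ^ n\<close>, a sum over all words up to length n costs
  only a geometric factor, which can be absorbed into the ratio of a growth bound.\<close>

lemma card_words_le:
  "real (card {\<eta> :: 'm::finite option list. length \<eta> \<le> n}) \<le> (2 * real CARD('m option)) ^ n"
proof -
  have "card {\<eta> :: 'm option list. length \<eta> \<le> n} = (\<Sum>i\<le>n. CARD('m option) ^ i)"
    using card_lists_length_le[of "UNIV :: 'm option set" n] by simp
  also have "\<dots> \<le> (\<Sum>i\<le>n. CARD('m option) ^ n)"
    by (intro sum_mono power_increasing) (auto simp: Suc_leI)
  also have "\<dots> = Suc n * CARD('m option) ^ n"
    by simp
  also have "\<dots> \<le> 2 ^ n * CARD('m option) ^ n"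
    by (intro mult_right_mono) (auto simp: Suc_le_eq)
  also have "\<dots> = (2 * CARD('m option)) ^ n"
    by (simp only: power_mult_distrib)
  finally have "real (card {\<eta> :: 'm::finite option list. length \<eta> \<le> n}) \<le> real ((2 * CARD('m option)) ^ n)"
    by (simp only: of_nat_le_iff)
  then show ?thesis by simp
qed

section \<open>Leibniz rule and binomial estimate for the shuffle product\<close>

lemma count_list_map_Cons:
  "count_list (map ((#) a) xss) (b # \<nu>) = (if a = b then count_list xss \<nu> else 0)"
  by (induction xss) auto

text \<open>The first letter of a shuffle is the first letter of one of the two factors; in this
  form the recursion also covers empty factors.\<close>

lemma count_shuffle_words_Cons:
  "count_list (shuffle_words u v) (a # \<nu>) =
     (case u of [] \<Rightarrow> 0 | b # u' \<Rightarrow> if b = a then count_list (shuffle_words u' v) \<nu> else 0)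
   + (case v of [] \<Rightarrow> 0 | b # v' \<Rightarrow> if b = a then count_list (shuffle_words u v') \<nu> else 0)"
proof -
  have [simp]: "shuffle_words w [] = [w]" for w :: "'a list"
    by (cases w) auto
  show ?thesis
    by (cases u; cases v) (auto simp: count_list_map_Cons)
qed

lemma shuffle_Nil: "shuffle c d [] = c [] * d []"
proof -
  have "{(u :: 'a option list, v :: 'a option list). length u + length v = length ([] :: 'a option list)} = {([], [])}"
    by auto
  then show ?thesis by (simp add: shuffle_def)
qed

text \<open>Removing a fixed first letter is a derivation of the shuffle algebra. This Leibniz rule
  lets the coefficient at a word be treated by induction on that word.\<close>

lemma shuffle_Cons:
  fixes c d :: "('m::finite, 'k::comm_ring_1) sseries"
  shows "shuffle c d (a # \<nu>) = shuffle (\<lambda>u. c (a # u)) d \<nu> + shuffle c (\<lambda>v. d (a # v)) \<nu>"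
proof -
  let ?P = "\<lambda>n. {(u :: 'm option list, v :: 'm option list). length u + length v = n}"
  let ?n = "length \<nu>"
  let ?F = "\<lambda>u v. c u * d v * of_nat (case u of [] \<Rightarrow> 0 | b # u' \<Rightarrow> if b = a then count_list (shuffle_words u' v) \<nu> else 0)"
  let ?G = "\<lambda>u v. c u * d v * of_nat (case v of [] \<Rightarrow> 0 | b # v' \<Rightarrow> if b = a then count_list (shuffle_words u v') \<nu> else 0)"
  have fin: "finite (?P n)" for n by (rule finite_word_pairs)
  have "shuffle c d (a # \<nu>) = (\<Sum>(u, v)\<in>?P (Suc ?n). ?F u v) + (\<Sum>(u, v)\<in>?P (Suc ?n). ?G u v)"
    unfolding shuffle_def sum.distrib[symmetric]
    by (rule sum.cong) (auto simp: count_shuffle_words_Cons algebra_simps)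
  \<comment> \<open>Only pairs whose first word starts with \<open>a\<close> contribute; deleting
    that letter leaves the pairs of total length \<open>?n\<close>. The sum of \<open>?G\<close> is
    treated in the same way.\<close>
  also have "(\<Sum>(u, v)\<in>?P (Suc ?n). ?F u v) = (\<Sum>(u, v)\<in>(\<lambda>(u, v). (a # u, v)) ` ?P ?n. ?F u v)"
    by (rule sum.mono_neutral_right[OF fin], force, auto split: list.splits if_splits simp: image_iff, blast)
  also have "\<dots> = shuffle (\<lambda>u. c (a # u)) d \<nu>"
    unfolding shuffle_def
    by (subst sum.reindex) (auto simp: inj_on_def intro!: sum.cong)
  also have "(\<Sum>(u, v)\<in>?P (Suc ?n). ?G u v) = (\<Sum>(u, v)\<in>(\<lambda>(u, v). (u, a # v)) ` ?P ?n. ?G u v)"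
    by (rule sum.mono_neutral_right[OF fin], force, auto split: list.splits if_splits simp: image_iff, blast)
  also have "\<dots> = shuffle c (\<lambda>v. d (a # v)) \<nu>"
    unfolding shuffle_def
    by (subst sum.reindex) (auto simp: inj_on_def intro!: sum.cong)
  finally show ?thesis .
qed

lemma shuffle_diff_left: "shuffle (\<lambda>u. c u - c' u) d \<nu> = shuffle c d \<nu> - shuffle c' d \<nu>"
  unfolding shuffle_def sum_subtractf[symmetric] by (rule sum.cong) (auto simp: algebra_simps)

lemma shuffle_diff_right: "shuffle c (\<lambda>u. d u - d' u) \<nu> = shuffle c d \<nu> - shuffle c d' \<nu>"
  unfolding shuffle_def sum_subtractf[symmetric] by (rule sum.cong) (auto simp: algebra_simps)

text \<open>Pascal's rule, written so that binomial convolutions obey the same Leibniz recursion as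
  \<open>shuffle_Cons\<close>.\<close>

lemma sum_binomial_Suc:
  fixes A B :: "nat \<Rightarrow> real"
  shows "(\<Sum>j\<le>Suc n. real (Suc n choose j) * A j * B (Suc n - j)) =
     (\<Sum>j\<le>n. real (n choose j) * A (Suc j) * B (n - j)) +
     (\<Sum>j\<le>n. real (n choose j) * A j * B (Suc (n - j)))"
proof -
  have "(\<Sum>j\<le>n. real (n choose j) * A j * B (Suc (n - j)))
      = (\<Sum>j\<le>Suc n. real (n choose j) * A j * B (Suc n - j))"
    by (simp add: Suc_diff_le)
  also have "\<dots> = A 0 * B (Suc n) + (\<Sum>j\<le>n. real (n choose Suc j) * A (Suc j) * B (n - j))"
    by (subst sum.atMost_Suc_shift) simp
  finally show ?thesis
    by (subst sum.atMost_Suc_shift) (simp add: algebra_simps sum.distrib)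
qed

text \<open>Both sides satisfy the same recursion in the word, so the multiplicities of shuffles
  never have to be counted. Only coefficients up to the length of \<open>\<nu>\<close>
  enter.\<close>

lemma norm_shuffle_le:
  fixes c d :: "('m::finite, 'k::real_normed_field) sseries"
  assumes "\<And>u. length u \<le> length \<nu> \<Longrightarrow> norm (c u) \<le> A (length u)"
    and "\<And>u. length u \<le> length \<nu> \<Longrightarrow> norm (d u) \<le> B (length u)"
  shows "norm (shuffle c d \<nu>) \<le>
    (\<Sum>j\<le>length \<nu>. real (length \<nu> choose j) * A j * B (length \<nu> - j))"
  using assms
proof (induction \<nu> arbitrary: c d A B)
  case Nil
  from Nil.prems(1)[of "[]"] Nil.prems(2)[of "[]"] show ?case
    by (simp add: shuffle_Nil norm_mult) (smt (verit) mult_mono norm_ge_zero)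
next
  case (Cons a \<nu>)
  have 1: "norm (shuffle (\<lambda>u. c (a # u)) d \<nu>) \<le>
      (\<Sum>j\<le>length \<nu>. real (length \<nu> choose j) * A (Suc j) * B (length \<nu> - j))"
    by (rule Cons.IH) (use Cons.prems(1)[of "a # _"] Cons.prems(2) in auto)
  have 2: "norm (shuffle c (\<lambda>u. d (a # u)) \<nu>) \<le>
      (\<Sum>j\<le>length \<nu>. real (length \<nu> choose j) * A j * B (Suc (length \<nu> - j)))"
    by (rule Cons.IH[where B = "\<lambda>j. B (Suc j)"]) (use Cons.prems(1) Cons.prems(2)[of "a # _"] in auto)
  show ?case
    unfolding shuffle_Cons length_Cons sum_binomial_Suc
    by (rule norm_triangle_le) (use 1 2 in linarith)
qed

lemma sum_power2_diff_le: "(\<Sum>l\<le>j. (2::real) ^ (j - l)) \<le> 2 ^ Suc j"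
proof -
  have "(\<Sum>l\<le>j. (2::real) ^ (j - l)) = (\<Sum>l\<le>j. 2 ^ l)"
    by (rule sum.nat_diff_reindex[of "\<lambda>l. 2 ^ l" "Suc j", simplified lessThan_Suc_atMost, simplified])
  also have "\<dots> \<le> 2 ^ Suc j"
    by (induction j) auto
  finally show ?thesis .
qed

text \<open>The factor \<open>1 / (k + 1)\<close> gained from prepending \<open>x\<^sub>0\<close> accumulates to \<open>1 / k!\<close>
  and so compensates the growth \<open>k!\<close> of the coefficients of the outer series.\<close>

lemma norm_left_x0_shuffle_le:
  fixes g e :: "('m::finite, 'k::real_normed_field) sseries"
  assumes g: "\<And>u. length u \<le> n \<Longrightarrow> norm (g u) \<le> C * q ^ length u * fact (length u)"
    and e: "\<And>u. length u \<le> n \<Longrightarrow>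
      norm (e u) \<le> (if k \<le> length u then E * (2 * q) ^ length u * fact (length u) else 0)"
    and nonneg: "0 \<le> C" "1 \<le> q" "0 \<le> E" and len: "length \<nu> \<le> n"
  shows "norm (left_x0 (shuffle g e) \<nu>) \<le>
    (if Suc k \<le> length \<nu> then C * E / Suc k * (2 * q) ^ length \<nu> * fact (length \<nu>) else 0)"
proof (cases "\<exists>\<nu>'. \<nu> = None # \<nu>'")
  case False
  then have "left_x0 (shuffle g e) \<nu> = 0"
    by (auto simp: left_x0_def split: list.splits)
  then show ?thesis using nonneg by simp
next
  case True
  then obtain \<nu>' where \<nu>: "\<nu> = None # \<nu>'" by blast
  define j where "j = length \<nu>'"
  let ?B = "\<lambda>l. if k \<le> l then E * (2 * q) ^ l * fact l else 0"
  have "norm (left_x0 (shuffle g e) \<nu>) = norm (shuffle g e \<nu>')"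
    by (simp add: \<nu> left_x0_def)
  also have "\<dots> \<le> (\<Sum>l\<le>j. real (j choose l) * (C * q ^ l * fact l) * ?B (j - l))"
    unfolding j_def
    by (rule norm_shuffle_le[where A = "\<lambda>l. C * q ^ l * fact l" and B = ?B])
      (use g e len \<nu> in simp_all)
  also have "\<dots> \<le> (if Suc k \<le> length \<nu> then C * E / Suc k * (2 * q) ^ length \<nu> * fact (length \<nu>) else 0)"
  proof (cases "k \<le> j")
    case False
    then have "(\<Sum>l\<le>j. real (j choose l) * (C * q ^ l * fact l) * ?B (j - l)) = 0"
      by (intro sum.neutral) auto
    with False show ?thesis by (simp add: \<nu> j_def[symmetric])
  next
    case True
    \<comment> \<open>Factorials and binomial coefficient combine to \<open>fact j\<close>. As the
      ratio of \<open>e\<close> is twice that of \<open>g\<close>, a factor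
      \<open>2 ^ (j - l)\<close> remains, and summing over \<open>l\<close> costs
      \<open>2 ^ Suc j\<close>, which fits \<open>length \<nu> = Suc j\<close>.\<close>
    have "real (j choose l) * (C * q ^ l * fact l) * ?B (j - l) \<le> C * E * q ^ j * fact j * 2 ^ (j - l)"
      if "l \<le> j" for l
    proof -
      have "real (j choose l) * (C * q ^ l * fact l) * ?B (j - l)
          \<le> real (j choose l) * (C * q ^ l * fact l) * (E * (2 * q) ^ (j - l) * fact (j - l))"
        using nonneg by (intro mult_left_mono) auto
      also have "\<dots> = C * E * (q ^ l * q ^ (j - l)) * (real (fact l * fact (j - l) * (j choose l))) * 2 ^ (j - l)"
        by (simp add: power_mult_distrib)
      also have "fact l * fact (j - l) * (j choose l) = fact j"
        using that by (rule binomial_fact_lemma)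
      also have "q ^ l * q ^ (j - l) = q ^ j"
        using that by (simp flip: power_add)
      finally show ?thesis by simp
    qed
    then have "(\<Sum>l\<le>j. real (j choose l) * (C * q ^ l * fact l) * ?B (j - l))
        \<le> (\<Sum>l\<le>j. C * E * q ^ j * fact j * 2 ^ (j - l))"
      by (intro sum_mono) auto
    also have "\<dots> = C * E * q ^ j * fact j * (\<Sum>l\<le>j. 2 ^ (j - l))"
      by (simp add: sum_distrib_left)
    also have "\<dots> \<le> C * E * q ^ j * fact j * 2 ^ Suc j"
      using nonneg by (intro mult_left_mono sum_power2_diff_le) auto
    also have "\<dots> \<le> C * E * q ^ Suc j * fact j * 2 ^ Suc j"
      using nonneg by (intro mult_right_mono mult_left_mono power_increasing) auto
    also have "\<dots> = C * E * (2 * q) ^ Suc j * fact j * 1"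
      by (simp add: power_mult_distrib)
    \<comment> \<open>The factor is at least 1 because \<open>k \<le> j\<close>; it turns
      \<open>fact j\<close> into \<open>fact (Suc j)\<close> and brings in the division by
      \<open>Suc k\<close>.\<close>
    also have "\<dots> \<le> C * E * (2 * q) ^ Suc j * fact j * (real (Suc j) / real (Suc k))"
      using nonneg True by (intro mult_left_mono) (auto simp: field_simps)
    also have "\<dots> = C * E / real (Suc k) * (2 * q) ^ Suc j * fact (Suc j)"
      by (simp add: field_simps)
    finally show ?thesis
      using True by (simp add: \<nu> j_def[symmetric])
  qed
  finally show ?thesis .
qed

section \<open>Estimates for the operators \<open>psi\<close>\<close>

lemma norm_comp_of_le:
  fixes d :: "('m::finite, 'k::real_normed_field) vseries"
  assumes "\<And>u i. length u \<le> n \<Longrightarrow> norm (d u i) \<le> C * q ^ length u * fact (length u)"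
    and "1 \<le> C" "1 \<le> q" "length u \<le> n"
  shows "norm (comp_of d a u) \<le> C * q ^ length u * fact (length u)"
  using assms by (cases a) (auto simp: comp_of_def one_series_def)

text \<open>Induction on \<open>\<eta>\<close>: the k-th application of a letter multiplies the
  bound by \<open>C / k\<close>, while the ratio \<open>2 * q\<close> stays the same however many
  letters are applied.\<close>

lemma norm_psi_le:
  fixes d :: "('m::finite, 'k::real_normed_field) vseries"
  assumes d: "\<And>u i. length u \<le> n \<Longrightarrow> norm (d u i) \<le> C * q ^ length u * fact (length u)"
    and C: "1 \<le> C" and q: "1 \<le> q" and "length \<nu> \<le> n"
  shows "norm (psi d \<eta> one_series \<nu>) \<le>
    (if length \<eta> \<le> length \<nu> then C ^ length \<eta> / fact (length \<eta>) * (2 * q) ^ length \<nu> * fact (length \<nu>) else 0)"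
  using assms(4)
proof (induction \<eta> arbitrary: \<nu>)
  case Nil
  then show ?case using q by (auto simp: one_series_def)
next
  case (Cons a \<eta>)
  have "norm (left_x0 (shuffle (comp_of d a) (psi d \<eta> one_series)) \<nu>) \<le>
    (if Suc (length \<eta>) \<le> length \<nu>
     then C * (C ^ length \<eta> / fact (length \<eta>)) / Suc (length \<eta>) * (2 * q) ^ length \<nu> * fact (length \<nu>) else 0)"
    by (rule norm_left_x0_shuffle_le[where n = n])
      (use Cons norm_comp_of_le[where d = d and n = n, OF d C q] C q in auto)
  also have "C * (C ^ length \<eta> / fact (length \<eta>)) / Suc (length \<eta>) = C ^ length (a # \<eta>) / fact (length (a # \<eta>))"
    by (simp add: fact_Suc mult.commute)
  finally show ?case
    by (simp only: psi.simps psi_letter_def length_Cons)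
qed

text \<open>A product rule: each letter of \<open>\<eta>\<close> is changed from \<open>d\<close> to
  \<open>d'\<close> once, at relative cost \<open>\<delta>\<close>, so the bound of
  \<open>norm_psi_le\<close> acquires the factor \<open>length \<eta> * \<delta>\<close>.\<close>

lemma norm_psi_diff_le:
  fixes d d' :: "('m::finite, 'k::real_normed_field) vseries"
  assumes d: "\<And>u i. length u \<le> n \<Longrightarrow> norm (d u i) \<le> C * q ^ length u * fact (length u)"
    and d': "\<And>u i. length u \<le> n \<Longrightarrow> norm (d' u i) \<le> C * q ^ length u * fact (length u)"
    and dd: "\<And>u i. length u \<le> n \<Longrightarrow> norm (d' u i - d u i) \<le> \<delta> * C * q ^ length u * fact (length u)"
    and C: "1 \<le> C" and q: "1 \<le> q" and \<delta>: "0 \<le> \<delta>" and "length \<nu> \<le> n"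
  shows "norm (psi d' \<eta> one_series \<nu> - psi d \<eta> one_series \<nu>) \<le>
    (if length \<eta> \<le> length \<nu>
     then real (length \<eta>) * \<delta> * C ^ length \<eta> / fact (length \<eta>) * (2 * q) ^ length \<nu> * fact (length \<nu>) else 0)"
  using assms(7)
proof (induction \<eta> arbitrary: \<nu>)
  case Nil
  then show ?case by simp
next
  case (Cons a \<eta>)
  let ?k = "length \<eta>"
  let ?D = "\<lambda>u. psi d' \<eta> one_series u - psi d \<eta> one_series u"
  let ?G = "\<lambda>u. comp_of d' a u - comp_of d a u"
  let ?X = "left_x0 (shuffle (comp_of d' a) ?D) \<nu>" and ?Y = "left_x0 (shuffle ?G (psi d \<eta> one_series)) \<nu>"
  \<comment> \<open>The mixed term with the new letter and the old series is inserted: the new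
    letter acts on the earlier difference, the change of the letter on the old series.\<close>
  have eq: "psi d' (a # \<eta>) one_series \<nu> - psi d (a # \<eta>) one_series \<nu> = ?X + ?Y"
    by (cases \<nu>) (auto simp: psi_letter_def left_x0_def shuffle_diff_left shuffle_diff_right)
  have X: "norm ?X \<le> (if Suc ?k \<le> length \<nu>
     then C * (real ?k * \<delta> * C ^ ?k / fact ?k) / Suc ?k * (2 * q) ^ length \<nu> * fact (length \<nu>) else 0)"
    by (rule norm_left_x0_shuffle_le[where n = n])
      (use Cons norm_comp_of_le[where d = d' and n = n, OF d' C q] C q \<delta> in auto)
  \<comment> \<open>For the letter \<open>None\<close> both components are
    \<open>one_series\<close>, so the difference vanishes.\<close>
  have G: "norm (?G u) \<le> \<delta> * C * q ^ length u * fact (length u)" if "length u \<le> n" for u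
    using that dd \<delta> C q by (cases a) (auto simp: comp_of_def)
  have Y: "norm ?Y \<le> (if Suc ?k \<le> length \<nu>
     then \<delta> * C * (C ^ ?k / fact ?k) / Suc ?k * (2 * q) ^ length \<nu> * fact (length \<nu>) else 0)"
    by (rule norm_left_x0_shuffle_le[where n = n])
      (use Cons.prems norm_psi_le[where d = d and n = n, OF d C q] G C q \<delta> in auto)
  show ?case
  proof (cases "Suc ?k \<le> length \<nu>")
    case False
    with X Y show ?thesis unfolding eq by (simp add: norm_triangle_le)
  next
    case True
    have "norm (?X + ?Y) \<le> C * (real ?k * \<delta> * C ^ ?k / fact ?k) / Suc ?k * (2 * q) ^ length \<nu> * fact (length \<nu>)
        + \<delta> * C * (C ^ ?k / fact ?k) / Suc ?k * (2 * q) ^ length \<nu> * fact (length \<nu>)"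
      using X Y True by (intro norm_triangle_le) simp
    also have "\<dots> = (C * (real ?k * \<delta> * C ^ ?k / fact ?k) / Suc ?k + \<delta> * C * (C ^ ?k / fact ?k) / Suc ?k) * (2 * q) ^ length \<nu> * fact (length \<nu>)"
      by (simp add: algebra_simps)
    \<comment> \<open>The two contributions k / k! and 1 / k!, each divided by k + 1, add up to (k +
      1) / (k + 1)!.\<close>
    also have "C * (real ?k * \<delta> * C ^ ?k / fact ?k) / Suc ?k + \<delta> * C * (C ^ ?k / fact ?k) / Suc ?k
       = real (Suc ?k) * \<delta> * C ^ Suc ?k / fact (Suc ?k)"
      by (simp add: divide_simps) (simp add: algebra_simps)
    finally show ?thesis unfolding eq using True by simp
  qed
qed

section \<open>Growth of the composition product\<close>

text \<open>Every letter of \<open>\<eta>\<close> prepends an \<open>x_0\<close>, so no word shorter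
  than \<open>\<eta>\<close> is reached. Hence the sum defining \<open>composition\<close> is finite
  at each word.\<close>

lemma psi_eq_0:
  fixes d :: "('m::finite, 'k::real_normed_field) vseries"
  assumes "length \<nu> < length \<eta>"
  shows "psi d \<eta> one_series \<nu> = 0"
  using assms
proof (induction \<eta> arbitrary: \<nu>)
  case (Cons a \<eta>)
  show ?case
  proof (cases \<nu>)
    case (Cons b \<nu>')
    have "shuffle (comp_of d a) (psi d \<eta> one_series) \<nu>' = 0"
      unfolding shuffle_def using Cons.IH Cons.prems Cons by (intro sum.neutral) auto
    then show ?thesis by (simp add: psi_letter_def left_x0_def Cons)
  qed (simp add: psi_letter_def left_x0_def)
qed simp

lemma composition_eq_sum:
  fixes c d :: "('m::finite, 'k::real_normed_field) vseries"
  shows "composition c d \<nu> i = (\<Sum>\<eta> | length \<eta> \<le> length \<nu>. c \<eta> i * psi d \<eta> one_series \<nu>)"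
proof -
  have "composition c d \<nu> i = (\<Sum>\<^sub>\<infinity>\<eta>\<in>{\<eta>. length \<eta> \<le> length \<nu>}. c \<eta> i * psi d \<eta> one_series \<nu>)"
    unfolding composition_def by (rule infsum_cong_neutral) (auto simp: psi_eq_0 not_le)
  then show ?thesis by (simp add: finite_words_le)
qed

lemma norm_sum_words_le:
  fixes f :: "'m::finite option list \<Rightarrow> 'k::real_normed_field"
  assumes "\<And>\<eta>. length \<eta> \<le> n \<Longrightarrow> norm (f \<eta>) \<le> K"
  shows "norm (\<Sum>\<eta> | length \<eta> \<le> n. f \<eta>) \<le> (2 * real CARD('m option)) ^ n * K"
proof -
  have "0 \<le> K" using assms[of "[]"] by (simp add: order_trans[OF norm_ge_zero])
  have "norm (\<Sum>\<eta> | length \<eta> \<le> n. f \<eta>) \<le> real (card {\<eta> :: 'm option list. length \<eta> \<le> n}) * K"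
    using sum_norm_bound[of "{\<eta>. length \<eta> \<le> n}" f K] assms by auto
  also have "\<dots> \<le> (2 * real CARD('m option)) ^ n * K"
    by (rule mult_right_mono[OF card_words_le \<open>0 \<le> K\<close>])
  finally show ?thesis .
qed

text \<open>The factor \<open>1 / fact (length \<eta>)\<close> from \<open>norm_psi_le\<close>
  cancels the factorial growth of \<open>c\<close>. The 4 collects one 2 from the number of words
  and one from the ratio \<open>2 * q\<close>. As bounds are assumed only up to the length of
  \<open>\<nu>\<close>, the constants may depend on that length.\<close>

lemma norm_composition_le:
  fixes c d :: "('m::finite, 'k::real_normed_field) vseries"
  assumes c: "\<And>u i. length u \<le> length \<nu> \<Longrightarrow> norm (c u i) \<le> A * p ^ length u * fact (length u)"
    and d: "\<And>u i. length u \<le> length \<nu> \<Longrightarrow> norm (d u i) \<le> C * q ^ length u * fact (length u)"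
    and "1 \<le> C" "1 \<le> q" "1 \<le> p" "0 \<le> A"
  shows "norm (composition c d \<nu> i) \<le> A * (4 * real CARD('m option) * p * C * q) ^ length \<nu> * fact (length \<nu>)"
proof -
  let ?n = "length \<nu>"
  have bound: "norm (c \<eta> i * psi d \<eta> one_series \<nu>) \<le> A * (p * C) ^ ?n * (2 * q) ^ ?n * fact ?n" if "length \<eta> \<le> ?n" for \<eta>
  proof -
    have bound: "norm (c \<eta> i * psi d \<eta> one_series \<nu>)
        \<le> (A * p ^ length \<eta> * fact (length \<eta>)) * (C ^ length \<eta> / fact (length \<eta>) * (2 * q) ^ ?n * fact ?n)"
      unfolding norm_mult
    proof (intro mult_mono)
      show "norm (psi d \<eta> one_series \<nu>) \<le> C ^ length \<eta> / fact (length \<eta>) * (2 * q) ^ ?n * fact ?n"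
        using norm_psi_le[where n = ?n and d = d and \<nu> = \<nu> and \<eta> = \<eta>, OF d assms(3,4) order_refl] that
        by simp
    qed (use c[OF that] assms(3-6) in auto)
    also have "\<dots> = A * (p * C) ^ length \<eta> * (2 * q) ^ ?n * fact ?n"
      by (simp add: power_mult_distrib)
    also have "\<dots> \<le> A * (p * C) ^ ?n * (2 * q) ^ ?n * fact ?n"
      using assms(3-6) that mult_mono[of 1 p 1 C] by (intro mult_right_mono mult_left_mono power_increasing) auto
    finally show ?thesis .
  qed
  have "norm (composition c d \<nu> i)
    \<le> (2 * real CARD('m option)) ^ ?n * (A * (p * C) ^ ?n * (2 * q) ^ ?n * fact ?n)"
    unfolding composition_eq_sum by (rule norm_sum_words_le) (rule bound)
  also have "\<dots> = A * ((2 * real CARD('m option)) ^ ?n * (p * C) ^ ?n * (2 * q) ^ ?n) * fact ?n"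
    by (simp only: mult_ac)
  also have "(2 * real CARD('m option)) ^ ?n * (p * C) ^ ?n * (2 * q) ^ ?n = (4 * real CARD('m option) * p * C * q) ^ ?n"
    unfolding power_mult_distrib[symmetric] by (simp add: algebra_simps)
  finally show ?thesis .
qed

text \<open>As for \<open>norm_composition_le\<close>; the additional factor
  \<open>length \<eta>\<close> of \<open>norm_psi_diff_le\<close> is bounded by
  \<open>2 ^ length \<nu>\<close>, whence 8 in place of 4.\<close>

lemma norm_composition_diff_right_le:
  fixes c d d' :: "('m::finite, 'k::real_normed_field) vseries"
  assumes c: "\<And>u i. length u \<le> length \<nu> \<Longrightarrow> norm (c u i) \<le> A * p ^ length u * fact (length u)"
    and d: "\<And>u i. length u \<le> length \<nu> \<Longrightarrow> norm (d u i) \<le> C * q ^ length u * fact (length u)"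
    and d': "\<And>u i. length u \<le> length \<nu> \<Longrightarrow> norm (d' u i) \<le> C * q ^ length u * fact (length u)"
    and dd: "\<And>u i. length u \<le> length \<nu> \<Longrightarrow> norm (d' u i - d u i) \<le> \<delta> * C * q ^ length u * fact (length u)"
    and "1 \<le> C" "1 \<le> q" "1 \<le> p" "0 \<le> A" "0 \<le> \<delta>"
  shows "norm (composition c d' \<nu> i - composition c d \<nu> i)
    \<le> A * \<delta> * (8 * real CARD('m option) * p * C * q) ^ length \<nu> * fact (length \<nu>)"
proof -
  let ?n = "length \<nu>"
  let ?D = "\<lambda>\<eta>. psi d' \<eta> one_series \<nu> - psi d \<eta> one_series \<nu>"
  have bound: "norm (c \<eta> i * ?D \<eta>) \<le> A * \<delta> * 2 ^ ?n * (p * C) ^ ?n * (2 * q) ^ ?n * fact ?n" if "length \<eta> \<le> ?n" for \<eta>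
  proof -
    have "real (length \<eta>) \<le> 2 ^ ?n"
      using that of_nat_less_two_power[of ?n, where 'a = real] by linarith
    have "norm (c \<eta> i * ?D \<eta>)
        \<le> (A * p ^ length \<eta> * fact (length \<eta>)) * (real (length \<eta>) * \<delta> * C ^ length \<eta> / fact (length \<eta>) * (2 * q) ^ ?n * fact ?n)"
      unfolding norm_mult
    proof (intro mult_mono)
      show "norm (?D \<eta>) \<le> real (length \<eta>) * \<delta> * C ^ length \<eta> / fact (length \<eta>) * (2 * q) ^ ?n * fact ?n"
        using norm_psi_diff_le[where n = ?n and d = d and d' = d' and \<nu> = \<nu> and \<eta> = \<eta>,
            OF d d' dd assms(5,6,9) order_refl] that
        by simp
    qed (use c[OF that] assms(5-9) in auto)
    also have "\<dots> = A * \<delta> * real (length \<eta>) * (p * C) ^ length \<eta> * (2 * q) ^ ?n * fact ?n"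
      by (simp add: power_mult_distrib)
    also have "\<dots> \<le> A * \<delta> * 2 ^ ?n * (p * C) ^ ?n * (2 * q) ^ ?n * fact ?n"
      using assms(5-9) that mult_mono[of 1 p 1 C] \<open>real (length \<eta>) \<le> 2 ^ ?n\<close>
      by (intro mult_right_mono mult_mono power_increasing) auto
    finally show ?thesis .
  qed
  have "norm (composition c d' \<nu> i - composition c d \<nu> i)
    \<le> (2 * real CARD('m option)) ^ ?n * (A * \<delta> * 2 ^ ?n * (p * C) ^ ?n * (2 * q) ^ ?n * fact ?n)"
    unfolding composition_eq_sum sum_subtractf[symmetric] right_diff_distrib[symmetric]
    by (rule norm_sum_words_le) (rule bound)
  also have "\<dots> = A * \<delta> * ((2 * real CARD('m option)) ^ ?n * 2 ^ ?n * (p * C) ^ ?n * (2 * q) ^ ?n) * fact ?n"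
    by (simp only: mult_ac)
  also have "(2 * real CARD('m option)) ^ ?n * 2 ^ ?n * (p * C) ^ ?n * (2 * q) ^ ?n = (8 * real CARD('m option) * p * C * q) ^ ?n"
    unfolding power_mult_distrib[symmetric] by (simp add: algebra_simps)
  finally show ?thesis .
qed


lemma composition_diff_left:
  fixes c c' d :: "('m::finite, 'k::real_normed_field) vseries"
  shows "composition c' d \<nu> i - composition c d \<nu> i = composition (\<lambda>\<eta> i. c' \<eta> i - c \<eta> i) d \<nu> i"
  unfolding composition_eq_sum by (simp add: sum_subtractf left_diff_distrib)

section \<open>Weighted balls and the Silva topology\<close>

text \<open>For \<open>v n = C * M ^ n\<close> with \<open>M > 0\<close> this is the closed ball of
  radius \<open>C\<close> in \<open>ell_inf M\<close>. General weights also admit series outside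
  \<open>LC\<close>, which is why intersections with \<open>LC\<close> appear below.\<close>

definition wball :: "(nat \<Rightarrow> real) \<Rightarrow> ('m, 'k::real_normed_field) vseries set" where
  "wball v = {c. \<forall>\<eta> i. norm (c \<eta> i) \<le> v (length \<eta>) * fact (length \<eta>)}"

lemma wballD: "c \<in> wball v \<Longrightarrow> norm (c \<eta> i) \<le> v (length \<eta>) * fact (length \<eta>)"
  by (simp add: wball_def)

lemma in_ell_inf_iff:
  assumes "0 < M"
  shows "c \<in> ell_inf M \<longleftrightarrow> (\<exists>C. c \<in> wball (\<lambda>n. C * M ^ n))"
  using assms by (auto simp: ell_inf_def bdd_above_def wball_def weighted_def divide_le_eq mult.assoc)

lemma ell_norm_le:
  fixes c :: "('m, 'k::real_normed_field) vseries"
  assumes "0 < M" "c \<in> wball (\<lambda>n. C * M ^ n)"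
  shows "ell_norm M c \<le> C"
  unfolding ell_norm_def using assms
  by (intro cSUP_least) (auto simp: wball_def weighted_def divide_le_eq mult.assoc)

lemma in_wball_ell_norm:
  fixes c :: "('m, 'k::real_normed_field) vseries"
  assumes "0 < M" "c \<in> ell_inf M"
  shows "c \<in> wball (\<lambda>n. ell_norm M c * M ^ n)"
proof -
  have "norm (c \<eta> i) \<le> ell_norm M c * M ^ length \<eta> * fact (length \<eta>)" for \<eta> i
  proof -
    have "weighted M c (\<eta>, i) \<le> ell_norm M c"
      unfolding ell_norm_def
      by (rule cSUP_upper) (use assms(2) in \<open>simp_all add: ell_inf_def\<close>)
    moreover have "0 < M ^ length \<eta> * fact (length \<eta>)"
      using assms(1) by simp
    ultimately show ?thesis
      by (simp add: weighted_def pos_divide_le_eq mult.assoc)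
  qed
  then show ?thesis
    by (simp add: wball_def)
qed

lemma wball_mono:
  fixes c :: "('m, 'k::real_normed_field) vseries"
  assumes "c \<in> wball v" "\<And>n. v n \<le> w n"
  shows "c \<in> wball w"
  unfolding wball_def
proof (intro CollectI allI)
  fix \<eta> :: "'m option list" and i :: 'm
  have "v (length \<eta>) * fact (length \<eta>) \<le> w (length \<eta>) * fact (length \<eta>)"
    by (intro mult_right_mono assms(2)) simp
  with wballD[OF assms(1), of \<eta> i] show "norm (c \<eta> i) \<le> w (length \<eta>) * fact (length \<eta>)"
    by linarith
qed

text \<open>Passing to larger constants only enlarges the ball, so both may be taken at least 1, as
  the growth estimates require.\<close>

lemma in_LC_iff:
  "c \<in> LC \<longleftrightarrow> (\<exists>C\<ge>1. \<exists>K\<ge>1. c \<in> wball (\<lambda>n. C * K ^ n))"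
proof
  assume "c \<in> LC"
  then obtain M where "0 < M" "c \<in> ell_inf M"
    by (auto simp: LC_def)
  then obtain C where "c \<in> wball (\<lambda>n. C * M ^ n)"
    using in_ell_inf_iff by blast
  moreover have "C * M ^ n \<le> max 1 C * max 1 M ^ n" for n
    using \<open>0 < M\<close> by (intro mult_mono power_mono) auto
  ultimately have "c \<in> wball (\<lambda>n. max 1 C * max 1 M ^ n)"
    by (rule wball_mono)
  then show "\<exists>C\<ge>1. \<exists>K\<ge>1. c \<in> wball (\<lambda>n. C * K ^ n)"
    by (intro exI[of _ "max 1 C"] conjI exI[of _ "max 1 M"]) auto
next
  assume "\<exists>C\<ge>1. \<exists>K\<ge>1. c \<in> wball (\<lambda>n. C * K ^ n)"
  then obtain C K where "1 \<le> K" "c \<in> wball (\<lambda>n. C * K ^ n)"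
    by blast
  then have "c \<in> ell_inf K" "0 < K"
    using in_ell_inf_iff[of K c] by auto
  then show "c \<in> LC"
    by (auto simp: LC_def)
qed

lemma LC_lincomb:
  fixes x y :: "('m, 'k::real_normed_field) vseries"
  assumes "x \<in> LC" "y \<in> LC"
  shows "(\<lambda>\<eta> i. a * x \<eta> i + b * y \<eta> i) \<in> LC"
proof -
  obtain C K where CK: "1 \<le> C" "1 \<le> K" "x \<in> wball (\<lambda>n. C * K ^ n)"
    using assms(1) in_LC_iff by blast
  obtain D L where DL: "1 \<le> D" "1 \<le> L" "y \<in> wball (\<lambda>n. D * L ^ n)"
    using assms(2) in_LC_iff by blast
  \<comment> \<open>Both series are compared at the larger ratio; the summand 1 keeps the constant
    at least 1 even if \<open>a\<close> and \<open>b\<close> vanish.\<close>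
  have "norm (a * x \<eta> i + b * y \<eta> i) \<le>
      (norm a * C + norm b * D + 1) * max K L ^ length \<eta> * fact (length \<eta>)" for \<eta> i
  proof -
    let ?n = "length \<eta>"
    have "norm (a * x \<eta> i + b * y \<eta> i) \<le> norm a * norm (x \<eta> i) + norm b * norm (y \<eta> i)"
      by (metis norm_mult norm_triangle_ineq)
    also have "\<dots> \<le> norm a * (C * K ^ ?n * fact ?n) + norm b * (D * L ^ ?n * fact ?n)"
      using CK(3) DL(3) by (intro add_mono mult_left_mono wballD) (auto dest: wballD)
    also have "\<dots> \<le> norm a * (C * max K L ^ ?n * fact ?n) + norm b * (D * max K L ^ ?n * fact ?n)"
      using CK DL by (intro add_mono mult_left_mono mult_right_mono power_mono) auto
    also have "\<dots> \<le> (norm a * C + norm b * D + 1) * max K L ^ ?n * fact ?n"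
      using CK DL by (simp add: algebra_simps)
    finally show ?thesis .
  qed
  then have "(\<lambda>\<eta> i. a * x \<eta> i + b * y \<eta> i) \<in> wball (\<lambda>n. (norm a * C + norm b * D + 1) * max K L ^ n)"
    by (simp add: wball_def)
  moreover have "1 \<le> norm a * C + norm b * D + 1" "1 \<le> max K L"
    using CK DL by auto
  ultimately show ?thesis
    unfolding in_LC_iff by blast
qed

lemma LC_add: "x \<in> LC \<Longrightarrow> y \<in> LC \<Longrightarrow> (\<lambda>\<eta> i. x \<eta> i + y \<eta> i) \<in> LC"
  using LC_lincomb[of x y 1 1] by simp

lemma LC_diff: "x \<in> LC \<Longrightarrow> y \<in> LC \<Longrightarrow> (\<lambda>\<eta> i. x \<eta> i - y \<eta> i) \<in> LC"
  using LC_lincomb[of x y 1 "- 1"] by simp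

section \<open>Weights that outgrow every geometric sequence\<close>

definition superexp :: "(nat \<Rightarrow> real) \<Rightarrow> bool" where
  "superexp v \<longleftrightarrow> (\<forall>M>0. \<exists>\<delta>>0. \<forall>n. \<delta> * M ^ n \<le> v n)"

lemma superexp_pos:
  assumes "superexp v"
  shows "0 < v n"
proof -
  obtain \<delta> where "\<delta> > 0" "\<forall>n. \<delta> * 1 ^ n \<le> v n"
    using assms unfolding superexp_def by (meson zero_less_one)
  then show ?thesis by (metis less_le_trans mult.right_neutral power_one)
qed

lemma superexp_scale:
  assumes "superexp v" "0 < a"
  shows "superexp (\<lambda>n. a * v n)"
  unfolding superexp_def
proof (intro allI impI)
  fix M :: real assume "0 < M"
  then obtain \<delta> where "\<delta> > 0" "\<forall>n. \<delta> * M ^ n \<le> v n"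
    using assms(1) unfolding superexp_def by blast
  then show "\<exists>\<delta>>0. \<forall>n. \<delta> * M ^ n \<le> a * v n"
    using assms(2) by (intro exI[of _ "a * \<delta>"]) (auto simp: mult.assoc)
qed

lemma superexp_min:
  assumes "superexp v" "superexp w"
  shows "superexp (\<lambda>n. min (v n) (w n))"
  unfolding superexp_def
proof (intro allI impI)
  fix M :: real assume M: "0 < M"
  obtain a where a: "a > 0" "\<And>n. a * M ^ n \<le> v n"
    using assms(1) M unfolding superexp_def by blast
  obtain b where b: "b > 0" "\<And>n. b * M ^ n \<le> w n"
    using assms(2) M unfolding superexp_def by blast
  have "min a b * M ^ n \<le> min (v n) (w n)" for n
  proof -
    have "min a b * M ^ n \<le> a * M ^ n" "min a b * M ^ n \<le> b * M ^ n"
      using M by (intro mult_right_mono; simp)+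
    with a(2)[of n] b(2)[of n] show ?thesis by simp
  qed
  then show "\<exists>\<delta>>0. \<forall>n. \<delta> * M ^ n \<le> min (v n) (w n)"
    using a b by (intro exI[of _ "min a b"]) auto
qed

text \<open>Positivity settles the finitely many indices below \<open>N\<close>: the constant is
  lowered to the least of the quotients there. Ratios below 1 are dominated by the ratio 1.\<close>

lemma superexpI:
  assumes pos: "\<And>n. 0 < v n"
    and ev: "\<And>M. 1 \<le> M \<Longrightarrow> \<exists>\<delta>>0. \<exists>N. \<forall>n\<ge>N. \<delta> * M ^ n \<le> v n"
  shows "superexp v"
  unfolding superexp_def
proof (intro allI impI)
  fix M :: real assume M: "0 < M"
  let ?M = "max 1 M"
  obtain \<delta> N where \<delta>: "\<delta> > 0" "\<And>n. n \<ge> N \<Longrightarrow> \<delta> * ?M ^ n \<le> v n"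
    using ev[of ?M] by auto
  define \<mu> where "\<mu> = Min (insert \<delta> ((\<lambda>n. v n / ?M ^ n) ` {..<N}))"
  have "\<mu> > 0"
    unfolding \<mu>_def using \<delta> pos by (auto simp: less_max_iff_disj)
  moreover have "\<mu> * M ^ n \<le> v n" for n
  proof -
    have "\<mu> * M ^ n \<le> \<mu> * ?M ^ n"
      using \<open>\<mu> > 0\<close> M by (intro mult_left_mono power_mono) auto
    also have "\<dots> \<le> v n"
    proof (cases "n < N")
      case True
      then have "\<mu> \<le> v n / ?M ^ n"
        unfolding \<mu>_def by (intro Min_le) auto
      moreover have "0 < ?M ^ n" by simp
      ultimately show ?thesis by (simp add: pos_le_divide_eq)
    next
      case False
      have "\<mu> \<le> \<delta>"
        unfolding \<mu>_def by (intro Min_le) auto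
      then have "\<mu> * ?M ^ n \<le> \<delta> * ?M ^ n"
        by (intro mult_right_mono) auto
      with \<delta>(2)[of n] False show ?thesis by linarith
    qed
    finally show ?thesis .
  qed
  ultimately show "\<exists>\<delta>>0. \<forall>n. \<delta> * M ^ n \<le> v n" by blast
qed

text \<open>At ratio \<open>2 * M\<close> the surplus \<open>2 ^ n\<close> eventually absorbs the
  constant \<open>\<delta>\<close>.\<close>

lemma superexp_eventually_ge:
  assumes "superexp v" "0 < M"
  shows "\<exists>N. \<forall>n\<ge>N. M ^ n \<le> v n"
proof -
  obtain \<delta> where \<delta>: "\<delta> > 0" "\<And>n. \<delta> * (2 * M) ^ n \<le> v n"
    using assms unfolding superexp_def by (metis zero_less_mult_iff zero_less_numeral)
  obtain N where N: "1 / \<delta> < 2 ^ N"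
    using real_arch_pow[of 2 "1 / \<delta>"] by auto
  have "M ^ n \<le> v n" if "n \<ge> N" for n
  proof -
    have "1 / \<delta> \<le> 2 ^ n"
      using N power_increasing[OF that, of "2 :: real"] by linarith
    then have "1 \<le> \<delta> * 2 ^ n"
      using \<delta> by (simp add: pos_divide_le_eq mult.commute)
    then have "1 * M ^ n \<le> \<delta> * 2 ^ n * M ^ n"
      using assms by (intro mult_right_mono) auto
    also have "\<dots> = \<delta> * (2 * M) ^ n"
      by (simp add: power_mult_distrib)
    finally show ?thesis using \<delta>(2)[of n] by simp
  qed
  then show ?thesis by blast
qed

text \<open>The factor \<open>s n\<close> occurs twice because the ratios of the bounds for the outer and for the inner
  series of a composition multiply.\<close>

lemma superexp_slow_base:
  assumes v: "superexp v" and L: "1 \<le> L"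
  shows "\<exists>s \<delta>. mono s \<and> (\<forall>n. 1 \<le> s n) \<and> 0 < \<delta> \<and> \<delta> \<le> 1 \<and>
    superexp (\<lambda>n. \<delta> * s n ^ n) \<and> (\<forall>n. \<delta> * (L * s n * s n) ^ n \<le> v n)"
proof -
  \<comment> \<open>\<open>A n\<close> collects the ratios whose bound by \<open>v\<close> holds
    from \<open>n\<close> on, and \<open>s n\<close> is the largest of them. Asking for all
    \<open>j \<ge> n\<close> makes \<open>A\<close> increasing, \<open>k \<le> n\<close> keeps it
    finite, and admitting 1 unconditionally keeps it nonempty.\<close>
  define A where "A n = {k :: nat. k = 1 \<or> 1 \<le> k \<and> k \<le> n \<and> (\<forall>j\<ge>n. (L * real k * real k) ^ j \<le> v j)}" for n
  define s where "s n = real (Max (A n))" for n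
  have fin: "finite (A n)" for n
    by (rule finite_subset[of _ "{..max 1 n}"]) (auto simp: A_def)
  have one: "1 \<in> A n" for n
    by (simp add: A_def)
  have Amono: "A n \<subseteq> A m" if "n \<le> m" for n m
    using that by (auto simp: A_def)
  have smono: "mono s"
    unfolding s_def by (intro monoI of_nat_mono Max_mono Amono fin) (use one in auto)
  have s1: "1 \<le> s n" for n
    unfolding s_def using Max_ge[OF fin one, of n] by linarith
  \<comment> \<open>A fixed \<open>k\<close> meets its condition from some index on. Hence
    \<open>s\<close> tends to infinity, which makes \<open>s n ^ n\<close> outgrow every geometric
    sequence.\<close>
  have unb: "\<exists>N. \<forall>n\<ge>N. M \<le> s n" for M
  proof -
    define k where "k = max 1 (nat \<lceil>M\<rceil>)"
    have k: "1 \<le> k" "M \<le> real k"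
      by (auto simp: k_def le_max_iff_disj) linarith
    have "0 < L * real k * real k"
      using L k by (intro mult_pos_pos) auto
    then obtain N where N: "\<And>j. j \<ge> N \<Longrightarrow> (L * real k * real k) ^ j \<le> v j"
      using superexp_eventually_ge[OF v] by blast
    have "M \<le> s n" if "n \<ge> max N k" for n
    proof -
      have "k \<in> A n"
        using k N that by (auto simp: A_def)
      then have "k \<le> Max (A n)"
        by (rule Max_ge[OF fin])
      with k show ?thesis unfolding s_def by linarith
    qed
    then show ?thesis by blast
  qed
  obtain \<delta>0 where \<delta>0: "\<delta>0 > 0" "\<And>n. \<delta>0 * L ^ n \<le> v n"
    using v L unfolding superexp_def by (metis less_le_trans zero_less_one)
  define \<delta> where "\<delta> = min 1 \<delta>0"
  have \<delta>: "0 < \<delta>" "\<delta> \<le> 1" "\<delta> \<le> \<delta>0"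
    using \<delta>0 by (auto simp: \<delta>_def)
  have "\<delta> * (L * s n * s n) ^ n \<le> v n" for n
  proof (cases "Max (A n) = 1")
    case True
    have "\<delta> * L ^ n \<le> \<delta>0 * L ^ n"
      using \<delta> L by (intro mult_right_mono) auto
    with True \<delta>0(2)[of n] show ?thesis by (simp add: s_def)
  next
    case False
    have "Max (A n) \<in> A n"
      by (rule Max_in[OF fin]) (use one in auto)
    with False have *: "(L * s n * s n) ^ n \<le> v n"
      by (auto simp: A_def s_def)
    have "0 \<le> (L * s n * s n) ^ n"
      using L s1[of n] by (intro zero_le_power mult_nonneg_nonneg) auto
    then have "\<delta> * (L * s n * s n) ^ n \<le> 1 * (L * s n * s n) ^ n"
      using \<delta> by (intro mult_right_mono) auto
    with * show ?thesis by simp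
  qed
  moreover have "superexp (\<lambda>n. \<delta> * s n ^ n)"
  proof (rule superexpI)
    show "0 < \<delta> * s n ^ n" for n
      using \<delta> s1[of n] by simp
    fix M :: real assume "1 \<le> M"
    obtain N where N: "\<And>n. n \<ge> N \<Longrightarrow> M \<le> s n"
      using unb by blast
    have "\<delta> * M ^ n \<le> \<delta> * s n ^ n" if "n \<ge> N" for n
      using \<delta> N[OF that] \<open>1 \<le> M\<close> by (intro mult_left_mono power_mono) auto
    with \<delta> show "\<exists>\<delta>'>0. \<exists>N. \<forall>n\<ge>N. \<delta>' * M ^ n \<le> \<delta> * s n ^ n"
      by blast
  qed
  ultimately show ?thesis
    using smono s1 \<delta> by blast
qed

section \<open>Weighted balls as a base of zero neighbourhoods\<close>

lemma absolutely_convex_wball: "absolutely_convex (wball v)"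
  unfolding absolutely_convex_def
proof (intro ballI allI impI)
  fix x y :: "('a, 'b) vseries" and a b :: 'b
  assume x: "x \<in> wball v" and y: "y \<in> wball v" and ab: "norm a + norm b \<le> 1"
  have "norm (a * x \<eta> i + b * y \<eta> i) \<le> v (length \<eta>) * fact (length \<eta>)" for \<eta> i
  proof -
    let ?B = "v (length \<eta>) * fact (length \<eta>)"
    have "0 \<le> ?B"
      using wballD[OF x, of \<eta> i] by (rule order_trans[OF norm_ge_zero])
    have "norm (a * x \<eta> i + b * y \<eta> i) \<le> norm a * norm (x \<eta> i) + norm b * norm (y \<eta> i)"
      by (metis norm_mult norm_triangle_ineq)
    also have "\<dots> \<le> norm a * ?B + norm b * ?B"
      by (intro add_mono mult_left_mono wballD x y) auto
    also have "\<dots> = (norm a + norm b) * ?B"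
      by (simp add: algebra_simps)
    also have "\<dots> \<le> 1 * ?B"
      using ab \<open>0 \<le> ?B\<close> by (rule mult_right_mono)
    finally show ?thesis by simp
  qed
  then show "(\<lambda>\<eta> i. a * x \<eta> i + b * y \<eta> i) \<in> wball v"
    by (simp add: wball_def)
qed

text \<open>In \<open>ell_inf M\<close> the constant \<open>\<delta>\<close> of
  \<open>superexp\<close> is the radius of a ball inside \<open>wball v\<close>.\<close>

lemma silva_zero_nbhd_wball:
  assumes "superexp v"
  shows "silva_zero_nbhd (wball v \<inter> LC)"
  unfolding silva_zero_nbhd_def
proof (intro conjI allI impI)
  show "absolutely_convex (wball v \<inter> LC :: ('a, 'b) vseries set)"
    using absolutely_convex_wball[of v] LC_lincomb unfolding absolutely_convex_def by blast
  fix M :: real assume M: "0 < M"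
  then obtain \<delta> where \<delta>: "\<delta> > 0" "\<And>n. \<delta> * M ^ n \<le> v n"
    using assms unfolding superexp_def by blast
  have "c \<in> wball v \<inter> LC" if "c \<in> ell_inf M" "ell_norm M c < \<delta>" for c :: "('a, 'b) vseries"
  proof -
    have "ell_norm M c * M ^ n \<le> v n" for n
      using \<delta>(2)[of n] mult_right_mono[of "ell_norm M c" \<delta> "M ^ n"] M that(2)
      by (meson less_imp_le order_trans zero_le_power)
    then have "c \<in> wball v"
      by (rule wball_mono[OF in_wball_ell_norm[OF M that(1)]])
    with that M show ?thesis by (auto simp: LC_def)
  qed
  with \<delta> show "\<exists>\<epsilon>>0. {c \<in> ell_inf M. ell_norm M c < \<epsilon>} \<subseteq> (wball v \<inter> LC :: ('a, 'b) vseries set)"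
    by blast
qed simp

lemma absolutely_convex_midpoint:
  fixes x y :: "('m, 'k::real_normed_field) vseries"
  assumes "absolutely_convex U" "x \<in> U" "y \<in> U"
  shows "(\<lambda>\<eta> i. of_real (1 / 2) * x \<eta> i + of_real (1 / 2) * y \<eta> i) \<in> U"
proof -
  have "norm (of_real (1 / 2) :: 'k) + norm (of_real (1 / 2) :: 'k) \<le> 1"
    unfolding norm_of_real by simp
  with assms show ?thesis
    unfolding absolutely_convex_def by blast
qed

text \<open>Induction by halving: the sum is the midpoint of \<open>u 0\<close> and the shorter sum
  for the shifted sequence; the zero series is the empty sum.\<close>

lemma absolutely_convex_dyadic_sum:
  fixes u :: "nat \<Rightarrow> ('m, 'k::real_normed_field) vseries"
  assumes "absolutely_convex U" "(\<lambda>\<eta> i. 0) \<in> U" "\<And>k. u k \<in> U"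
  shows "(\<lambda>\<eta> i. \<Sum>k<N. of_real ((1 / 2) ^ Suc k) * u k \<eta> i) \<in> U"
  using assms(3)
proof (induction N arbitrary: u)
  case 0
  then show ?case using assms(2) by simp
next
  case (Suc N)
  let ?S = "\<lambda>\<eta> i. \<Sum>k<N. of_real ((1 / 2) ^ Suc k) * u (Suc k) \<eta> i"
  have "?S \<in> U"
    by (rule Suc.IH) (rule Suc.prems)
  from absolutely_convex_midpoint[OF assms(1) Suc.prems[of 0] this] show ?case
    by (simp only: sum.lessThan_Suc_shift sum_distrib_left power_Suc power_0 of_real_mult mult.assoc mult_1_right mult_1_left of_real_1)
qed

text \<open>The weight \<open>v n\<close> is a sum of \<open>2^-(k+2)\<close> times the radii of balls of the \<open>k\<close>-th step contained
  in \<open>U\<close>, over \<open>k \<le> n\<close> only, so that it is finite. Distributing a series proportionally over these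
  summands gives a dyadic sum of elements of \<open>U\<close>; what is left after \<open>N\<close> summands vanishes on words
  shorter than \<open>N\<close> and hence is small in a step strictly larger than that of the series.\<close>

lemma silva_zero_nbhd_contains_wball:
  fixes U :: "('m, 'k::real_normed_field) vseries set"
  assumes "silva_zero_nbhd U"
  shows "\<exists>v. superexp v \<and> wball v \<inter> LC \<subseteq> U"
proof -
  have conv: "absolutely_convex U"
    using assms by (simp add: silva_zero_nbhd_def)
  have "\<exists>e>0. wball (\<lambda>n. e * real (Suc k) ^ n) \<subseteq> U" for k
  proof -
    have "0 < real (Suc k)" by simp
    then obtain e where e: "e > 0" "{c \<in> ell_inf (real (Suc k)). ell_norm (real (Suc k)) c < e} \<subseteq> U"
      using assms unfolding silva_zero_nbhd_def by blast
    \<comment> \<open>The radius is halved because \<open>wball\<close> is given by non-strict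
      inequalities, whereas the ball known to lie in \<open>U\<close> is open.\<close>
    have "c \<in> U" if c: "c \<in> wball (\<lambda>n. e / 2 * real (Suc k) ^ n)" for c
    proof -
      have "c \<in> ell_inf (real (Suc k))"
        using c in_ell_inf_iff[of "real (Suc k)" c] by (metis \<open>0 < real (Suc k)\<close>)
      moreover have "ell_norm (real (Suc k)) c \<le> e / 2"
        by (rule ell_norm_le) (use c in auto)
      ultimately show ?thesis using e by auto
    qed
    with e show ?thesis by (intro exI[of _ "e / 2"]) auto
  qed
  then have "\<exists>e. \<forall>k. e k > 0 \<and> wball (\<lambda>n. e k * real (Suc k) ^ n) \<subseteq> U"
    by (intro choice allI)
  then obtain e where e: "\<And>k. e k > 0" "\<And>k. wball (\<lambda>n. e k * real (Suc k) ^ n) \<subseteq> U"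
    by blast
  \<comment> \<open>Of the \<open>k + 2\<close> halvings, \<open>k + 1\<close> are used by the
    dyadic sum and one by the midpoint with the remainder.\<close>
  define w where "w k n = (1 / 2) ^ (k + 2) * e k * real (Suc k) ^ n" for k n
  define v where "v n = (\<Sum>k\<le>n. w k n)" for n
  have w: "0 < w k n" for k n
    using e(1) by (simp add: w_def)
  have v: "0 < v n" for n
    unfolding v_def using w by (intro sum_pos) auto
  have wv: "w k n \<le> v n" if "k \<le> n" for k n
    unfolding v_def using w that by (intro member_le_sum) (auto simp: less_imp_le)
  have "superexp v"
  proof (rule superexpI[OF v])
    fix M :: real assume "1 \<le> M"
    obtain k where k: "M \<le> real k"
      using real_arch_simple by blast
    have "(1 / 2) ^ (k + 2) * e k * M ^ n \<le> v n" if "n \<ge> k" for n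
    proof -
      have "(1 / 2) ^ (k + 2) * e k * M ^ n \<le> w k n"
        unfolding w_def using e(1)[of k] k \<open>1 \<le> M\<close> by (intro mult_left_mono power_mono) auto
      with wv[OF that] show ?thesis by linarith
    qed
    with e(1)[of k] show "\<exists>\<delta>>0. \<exists>N. \<forall>n\<ge>N. \<delta> * M ^ n \<le> v n"
      by (intro exI[of _ "(1 / 2) ^ (k + 2) * e k"] conjI exI[of _ k]) auto
  qed
  moreover have "c \<in> U" if cv: "c \<in> wball v" and cLC: "c \<in> LC" for c
  proof -
    \<comment> \<open>\<open>r k n\<close> is the share of the k-th summand in \<open>v n\<close>,
      hence 0 for \<open>k > n\<close>. The factor \<open>2 ^ (k + 2)\<close> in \<open>u k\<close>
      cancels the halvings to come.\<close>
    define r where "r k n = (if k \<le> n then w k n / v n else 0)" for k n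
    define u where "u k = (\<lambda>\<eta> i. of_real (2 ^ (k + 2) * r k (length \<eta>)) * c \<eta> i)" for k
    have r0: "0 \<le> r k n" for k n
      using w v by (simp add: r_def less_imp_le)
    have uU: "u k \<in> U" for k
    proof -
      have "norm (u k \<eta> i) \<le> e k * real (Suc k) ^ length \<eta> * fact (length \<eta>)" for \<eta> i
      proof -
        let ?n = "length \<eta>"
        have "norm (u k \<eta> i) = 2 ^ (k + 2) * r k ?n * norm (c \<eta> i)"
          unfolding u_def norm_mult norm_of_real using r0[of k ?n] by (simp add: abs_mult)
        also have "\<dots> \<le> 2 ^ (k + 2) * r k ?n * (v ?n * fact ?n)"
          using r0 by (intro mult_left_mono wballD[OF cv]) auto
        also have "\<dots> \<le> 2 ^ (k + 2) * (w k ?n * fact ?n)"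
          using v[of ?n] w[of k ?n] by (simp add: r_def)
        also have "\<dots> = e k * real (Suc k) ^ ?n * fact ?n"
          by (simp add: w_def power_divide)
        finally show ?thesis .
      qed
      then have "u k \<in> wball (\<lambda>n. e k * real (Suc k) ^ n)"
        by (simp add: wball_def)
      with e(2) show ?thesis by blast
    qed
    obtain C K where CK: "1 \<le> C" "1 \<le> K" "c \<in> wball (\<lambda>n. C * K ^ n)"
      using cLC in_LC_iff by blast
    \<comment> \<open>Step \<open>l\<close> has a ratio of at least \<open>2 * K\<close>, which
      leaves a surplus \<open>2 ^ n\<close>; from \<open>N\<close> on this surplus outweighs
      \<open>2 * C / e l\<close>.\<close>
    obtain l where l: "2 * K \<le> real l"
      using real_arch_simple by blast
    obtain N where N: "2 * C / e l < 2 ^ N"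
      using real_arch_pow[of 2 "2 * C / e l"] by auto
    define \<rho> where "\<rho> n = (\<Sum>k<N. r k n)" for n
    have sum_r: "(\<Sum>k\<le>n. r k n) = 1" for n
    proof -
      have "(\<Sum>k\<le>n. r k n) = (\<Sum>k\<le>n. w k n) / v n"
        unfolding r_def sum_divide_distrib by (rule sum.cong) auto
      then show ?thesis using v[of n] by (simp add: v_def)
    qed
    have \<rho>0: "0 \<le> \<rho> n" for n
      unfolding \<rho>_def using r0 by (intro sum_nonneg) auto
    have \<rho>1: "\<rho> n \<le> 1" for n
    proof -
      have "\<rho> n \<le> (\<Sum>k\<in>{..<N} \<union> {..n}. r k n)"
        unfolding \<rho>_def by (rule sum_mono2) (auto simp: r0)
      also have "\<dots> = (\<Sum>k\<le>n. r k n)"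
        by (rule sum.mono_neutral_right) (auto simp: r_def)
      finally show ?thesis using sum_r by simp
    qed
    \<comment> \<open>For \<open>n < N\<close> all nonzero shares are among the first
      \<open>N\<close>, so nothing is left over on short words.\<close>
    have \<rho>eq: "\<rho> n = 1" if "n < N" for n
    proof -
      have "\<rho> n = (\<Sum>k\<le>n. r k n)"
        unfolding \<rho>_def by (rule sum.mono_neutral_right) (use that in \<open>auto simp: r_def\<close>)
      then show ?thesis using sum_r by simp
    qed
    \<comment> \<open>The remainder is doubled, since the final midpoint halves it.\<close>
    define T where "T = (\<lambda>\<eta> i. of_real (2 * (1 - \<rho> (length \<eta>))) * c \<eta> i)"
    have "norm (T \<eta> i) \<le> e l * real (Suc l) ^ length \<eta> * fact (length \<eta>)" for \<eta> i
    proof (cases "length \<eta> < N")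
      case True
      then show ?thesis using \<rho>eq e(1)[of l] by (simp add: T_def less_imp_le)
    next
      case False
      let ?n = "length \<eta>"
      have "norm (T \<eta> i) = 2 * (1 - \<rho> ?n) * norm (c \<eta> i)"
        unfolding T_def norm_mult norm_of_real using \<rho>1[of ?n] by simp
      also have "\<dots> \<le> 2 * 1 * (C * K ^ ?n * fact ?n)"
        using \<rho>0[of ?n] \<rho>1[of ?n] wballD[OF CK(3), of \<eta> i] by (intro mult_mono) auto
      also have "\<dots> = 2 * C * (K ^ ?n * fact ?n)"
        by simp
      also have "\<dots> \<le> (e l * 2 ^ ?n) * (K ^ ?n * fact ?n)"
      proof (rule mult_right_mono)
        have "2 * C / e l \<le> 2 ^ ?n"
          using N False power_increasing[of N ?n "2 :: real"] by linarith
        then show "2 * C \<le> e l * 2 ^ ?n"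
          using e(1)[of l] by (simp add: pos_divide_le_eq mult.commute)
      qed (use CK in auto)
      also have "\<dots> = e l * (2 * K) ^ ?n * fact ?n"
        by (simp add: power_mult_distrib)
      also have "\<dots> \<le> e l * real (Suc l) ^ ?n * fact ?n"
        using e(1)[of l] CK l by (intro mult_right_mono mult_left_mono power_mono) auto
      finally show ?thesis .
    qed
    then have "T \<in> wball (\<lambda>n. e l * real (Suc l) ^ n)"
      by (simp add: wball_def)
    then have TU: "T \<in> U" using e(2) by blast
    have "(\<lambda>\<eta> i. 0) \<in> wball (\<lambda>n. e 0 * real (Suc 0) ^ n)"
      using e(1)[of 0] by (simp add: wball_def less_imp_le)
    with e(2) have "(\<lambda>\<eta> i. 0) \<in> U"
      by blast
    then have "(\<lambda>\<eta> i. \<Sum>k<N. of_real ((1 / 2) ^ Suc k) * u k \<eta> i) \<in> U" (is "?P \<in> U")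
      by (rule absolutely_convex_dyadic_sum[OF conv]) (rule uU)
    from absolutely_convex_midpoint[OF conv this TU]
    have "(\<lambda>\<eta> i. of_real (1 / 2) * ?P \<eta> i + of_real (1 / 2) * T \<eta> i) \<in> U" .
    also have "(\<lambda>\<eta> i. of_real (1 / 2) * ?P \<eta> i + of_real (1 / 2) * T \<eta> i) = c"
    proof (intro ext)
      fix \<eta> i
      have "?P \<eta> i = (\<Sum>k<N. of_real (2 * r k (length \<eta>)) * c \<eta> i)"
        unfolding u_def mult.assoc[symmetric] of_real_mult[symmetric]
        by (intro sum.cong refl arg_cong2[where f = "(*)"] arg_cong[where f = of_real]) (simp add: power_divide)
      also have "\<dots> = of_real (2 * \<rho> (length \<eta>)) * c \<eta> i"
        by (simp add: \<rho>_def sum_distrib_left sum_distrib_right)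
      finally have P: "?P \<eta> i = of_real (2 * \<rho> (length \<eta>)) * c \<eta> i" .
      have "of_real (1 / 2) * ?P \<eta> i + of_real (1 / 2) * T \<eta> i
          = of_real (1 / 2 * (2 * \<rho> (length \<eta>)) + 1 / 2 * (2 * (1 - \<rho> (length \<eta>)))) * c \<eta> i"
        unfolding P T_def of_real_add of_real_mult by (simp only: distrib_right mult.assoc)
      also have "1 / 2 * (2 * \<rho> (length \<eta>)) + 1 / 2 * (2 * (1 - \<rho> (length \<eta>))) = 1"
        by (simp add: field_simps)
      finally show "of_real (1 / 2) * ?P \<eta> i + of_real (1 / 2) * T \<eta> i = c \<eta> i"
        by simp
    qed
    finally show ?thesis .
  qed
  ultimately show ?thesis by blast
qed

section \<open>Open sets of the Silva topology described by weights\<close>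

lemma openin_silva_topology:
  fixes S :: "('m, 'k::real_normed_field) vseries set"
  shows "openin silva_topology S \<longleftrightarrow> S \<subseteq> LC \<and>
    (\<forall>x\<in>S. \<exists>v. superexp v \<and> (\<forall>y\<in>LC. (\<lambda>\<eta> i. y \<eta> i - x \<eta> i) \<in> wball v \<longrightarrow> y \<in> S))"
proof -
  let ?Q = "\<lambda>S :: ('m, 'k) vseries set. S \<subseteq> LC \<and>
    (\<forall>x\<in>S. \<exists>v. superexp v \<and> (\<forall>y\<in>LC. (\<lambda>\<eta> i. y \<eta> i - x \<eta> i) \<in> wball v \<longrightarrow> y \<in> S))"
  let ?P = "\<lambda>S :: ('m, 'k) vseries set. S \<subseteq> LC \<and>
     (\<forall>x\<in>S. \<exists>U. silva_zero_nbhd U \<and> (\<lambda>u. (\<lambda>\<eta> i. x \<eta> i + u \<eta> i)) ` U \<subseteq> S)"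
  \<comment> \<open>One direction holds because every zero neighbourhood contains a weighted ball
    cut with \<open>LC\<close>, the other because these sets are zero neighbourhoods
    themselves.\<close>
  have step: "(\<exists>U. silva_zero_nbhd U \<and> (\<lambda>u. (\<lambda>\<eta> i. x \<eta> i + u \<eta> i)) ` U \<subseteq> S) \<longleftrightarrow>
      (\<exists>v. superexp v \<and> (\<forall>y\<in>LC. (\<lambda>\<eta> i. y \<eta> i - x \<eta> i) \<in> wball v \<longrightarrow> y \<in> S))"
    if x: "x \<in> LC" for x and S :: "('m, 'k) vseries set"
  proof
    assume "\<exists>U. silva_zero_nbhd U \<and> (\<lambda>u. (\<lambda>\<eta> i. x \<eta> i + u \<eta> i)) ` U \<subseteq> S"
    then obtain U where U: "silva_zero_nbhd U" "(\<lambda>u. (\<lambda>\<eta> i. x \<eta> i + u \<eta> i)) ` U \<subseteq> S"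
      by blast
    obtain v where v: "superexp v" "wball v \<inter> LC \<subseteq> U"
      using silva_zero_nbhd_contains_wball[OF U(1)] by blast
    have "y \<in> S" if "y \<in> LC" "(\<lambda>\<eta> i. y \<eta> i - x \<eta> i) \<in> wball v" for y
    proof -
      have "(\<lambda>\<eta> i. y \<eta> i - x \<eta> i) \<in> U"
        using that v(2) LC_diff[OF that(1) x] by blast
      from subsetD[OF U(2) imageI[OF this]] show ?thesis by simp
    qed
    with v(1) show "\<exists>v. superexp v \<and> (\<forall>y\<in>LC. (\<lambda>\<eta> i. y \<eta> i - x \<eta> i) \<in> wball v \<longrightarrow> y \<in> S)"
      by blast
  next
    assume "\<exists>v. superexp v \<and> (\<forall>y\<in>LC. (\<lambda>\<eta> i. y \<eta> i - x \<eta> i) \<in> wball v \<longrightarrow> y \<in> S)"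
    then obtain v where v: "superexp v" "\<And>y. y \<in> LC \<Longrightarrow> (\<lambda>\<eta> i. y \<eta> i - x \<eta> i) \<in> wball v \<Longrightarrow> y \<in> S"
      by blast
    have "(\<lambda>u. (\<lambda>\<eta> i. x \<eta> i + u \<eta> i)) ` (wball v \<inter> LC) \<subseteq> S"
      using v(2) LC_add[OF x] by auto
    with silva_zero_nbhd_wball[OF v(1)]
    show "\<exists>U. silva_zero_nbhd U \<and> (\<lambda>u. (\<lambda>\<eta> i. x \<eta> i + u \<eta> i)) ` U \<subseteq> S"
      by blast
  qed
  have PQ: "?P = ?Q"
    using step by (intro ext conj_cong refl ball_cong) blast
  \<comment> \<open>With weights, closure under intersection amounts to taking the minimum of two
    weights.\<close>
  have "istopology ?Q"
    unfolding istopology_def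
  proof (intro conjI allI impI)
    fix S T assume S: "?Q S" and T: "?Q T"
    show "S \<inter> T \<subseteq> LC" using S by blast
    show "\<forall>x\<in>S \<inter> T. \<exists>v. superexp v \<and> (\<forall>y\<in>LC. (\<lambda>\<eta> i. y \<eta> i - x \<eta> i) \<in> wball v \<longrightarrow> y \<in> S \<inter> T)"
    proof
      fix x assume x: "x \<in> S \<inter> T"
      obtain v where v: "superexp v" "\<And>y. y \<in> LC \<Longrightarrow> (\<lambda>\<eta> i. y \<eta> i - x \<eta> i) \<in> wball v \<Longrightarrow> y \<in> S"
        using S x by blast
      obtain w where w: "superexp w" "\<And>y. y \<in> LC \<Longrightarrow> (\<lambda>\<eta> i. y \<eta> i - x \<eta> i) \<in> wball w \<Longrightarrow> y \<in> T"
        using T x by blast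
      have "u \<in> wball v \<and> u \<in> wball w" if "u \<in> wball (\<lambda>n. min (v n) (w n))" for u :: "('m, 'k) vseries"
        using that by (auto intro: wball_mono[OF that])
      then show "\<exists>v. superexp v \<and> (\<forall>y\<in>LC. (\<lambda>\<eta> i. y \<eta> i - x \<eta> i) \<in> wball v \<longrightarrow> y \<in> S \<inter> T)"
        using superexp_min[OF v(1) w(1)] v(2) w(2) by blast
    qed
  next
    fix \<K> assume \<K>: "\<forall>K\<in>\<K>. ?Q K"
    show "\<Union>\<K> \<subseteq> LC" using \<K> by blast
    show "\<forall>x\<in>\<Union>\<K>. \<exists>v. superexp v \<and> (\<forall>y\<in>LC. (\<lambda>\<eta> i. y \<eta> i - x \<eta> i) \<in> wball v \<longrightarrow> y \<in> \<Union>\<K>)"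
      using \<K> by (meson UnionE UnionI)
  qed
  then show ?thesis
    unfolding silva_topology_def PQ by simp
qed

lemma superexp_ex: "\<exists>v. superexp v"
proof
  show "superexp (\<lambda>n. (real n + 1) ^ n)"
  proof (rule superexpI)
    fix M :: real assume "1 \<le> M"
    obtain N where "M \<le> real N"
      using real_arch_simple by blast
    then have "1 * M ^ n \<le> (real n + 1) ^ n" if "n \<ge> N" for n
      using that \<open>1 \<le> M\<close> by (simp add: power_mono)
    then show "\<exists>\<delta>>0. \<exists>N. \<forall>n\<ge>N. \<delta> * M ^ n \<le> (real n + 1) ^ n"
      using zero_less_one by blast
  qed simp
qed

lemma topspace_silva_topology: "topspace silva_topology = (LC :: ('m, 'k::real_normed_field) vseries set)"
proof
  show "topspace silva_topology \<subseteq> (LC :: ('m, 'k) vseries set)"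
    unfolding topspace_def by (auto simp: openin_silva_topology)
  have "openin silva_topology (LC :: ('m, 'k) vseries set)"
    using superexp_ex by (auto simp: openin_silva_topology)
  then show "(LC :: ('m, 'k) vseries set) \<subseteq> topspace silva_topology"
    by (rule openin_subset)
qed

text \<open>The translate of \<open>wball v\<close> is shrunk to differences in
  \<open>wball (\<lambda>n. r * v n)\<close> for some \<open>r < 1\<close>, so that the margin
  \<open>1 - r\<close> gives openness at every point.\<close>

lemma silva_open_nbhd:
  fixes x :: "('m, 'k::real_normed_field) vseries"
  assumes x: "x \<in> LC" and v: "superexp v"
  obtains S where "openin silva_topology S" "x \<in> S" "\<And>y. y \<in> S \<Longrightarrow> (\<lambda>\<eta> i. y \<eta> i - x \<eta> i) \<in> wball v"
proof
  let ?S = "{y \<in> LC. \<exists>r<1. (\<lambda>\<eta> i. y \<eta> i - x \<eta> i) \<in> wball (\<lambda>n. r * v n)}"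
  show "openin silva_topology ?S"
    unfolding openin_silva_topology
  proof (intro conjI ballI)
    fix y assume "y \<in> ?S"
    then obtain r where r: "r < 1" "(\<lambda>\<eta> i. y \<eta> i - x \<eta> i) \<in> wball (\<lambda>n. r * v n)"
      by blast
    \<comment> \<open>Only half of the margin is used, so the new factor \<open>(1 + r) / 2\<close>
      is still below 1.\<close>
    have "z \<in> ?S" if z: "z \<in> LC" "(\<lambda>\<eta> i. z \<eta> i - y \<eta> i) \<in> wball (\<lambda>n. (1 - r) / 2 * v n)" for z
    proof -
      have "norm (z \<eta> i - x \<eta> i) \<le> (1 + r) / 2 * v (length \<eta>) * fact (length \<eta>)" for \<eta> i
      proof -
        have "norm (z \<eta> i - x \<eta> i) \<le> norm (z \<eta> i - y \<eta> i) + norm (y \<eta> i - x \<eta> i)"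
          using norm_triangle_ineq[of "z \<eta> i - y \<eta> i" "y \<eta> i - x \<eta> i"] by simp
        also have "\<dots> \<le> (1 - r) / 2 * v (length \<eta>) * fact (length \<eta>) + r * v (length \<eta>) * fact (length \<eta>)"
          by (intro add_mono wballD[OF z(2)] wballD[OF r(2)])
        also have "\<dots> = (1 + r) / 2 * v (length \<eta>) * fact (length \<eta>)"
          by (simp add: field_simps)
        finally show ?thesis .
      qed
      then have "(\<lambda>\<eta> i. z \<eta> i - x \<eta> i) \<in> wball (\<lambda>n. (1 + r) / 2 * v n)"
        by (simp add: wball_def)
      moreover have "(1 + r) / 2 < 1" using r by simp
      ultimately show ?thesis using z by blast
    qed
    moreover have "superexp (\<lambda>n. (1 - r) / 2 * v n)"
      using r by (intro superexp_scale v) simp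
    ultimately show "\<exists>v. superexp v \<and> (\<forall>z\<in>LC. (\<lambda>\<eta> i. z \<eta> i - y \<eta> i) \<in> wball v \<longrightarrow> z \<in> ?S)"
      by blast
  qed blast
  have "(\<lambda>\<eta> i. x \<eta> i - x \<eta> i) \<in> wball (\<lambda>n. 0 * v n)"
    by (simp add: wball_def)
  then show "x \<in> ?S"
    using x zero_less_one by blast
  fix y assume "y \<in> ?S"
  then obtain r where r: "r < 1" "(\<lambda>\<eta> i. y \<eta> i - x \<eta> i) \<in> wball (\<lambda>n. r * v n)"
    by blast
  from r(2) show "(\<lambda>\<eta> i. y \<eta> i - x \<eta> i) \<in> wball v"
    by (rule wball_mono) (use r(1) superexp_pos[OF v] in simp)
qed

section \<open>Continuity\<close>

lemma composition_in_LC: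
  fixes c d :: "('m::finite, 'k::real_normed_field) vseries"
  assumes "c \<in> LC" "d \<in> LC"
  shows "composition c d \<in> LC"
proof -
  obtain A p where A: "1 \<le> A" "1 \<le> p" "c \<in> wball (\<lambda>n. A * p ^ n)"
    using assms(1) in_LC_iff by blast
  obtain C q where C: "1 \<le> C" "1 \<le> q" "d \<in> wball (\<lambda>n. C * q ^ n)"
    using assms(2) in_LC_iff by blast
  let ?K = "4 * real CARD('m option) * p * C * q"
  have "norm (composition c d \<nu> i) \<le> A * ?K ^ length \<nu> * fact (length \<nu>)" for \<nu> i
    by (rule norm_composition_le) (use A C in \<open>auto dest: wballD\<close>)
  then have "composition c d \<in> wball (\<lambda>n. A * ?K ^ n)"
    by (simp add: wball_def)
  then have "composition c d \<in> ell_inf ?K" "0 < ?K"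
    using A C by (auto simp: in_ell_inf_iff)
  then show ?thesis
    unfolding LC_def by blast
qed

text \<open>Continuity at \<open>(c, d)\<close> in terms of weights. The outer series is changed
  first, with \<open>d'\<close> fixed, and then the inner one.\<close>

lemma composition_diff_in_wball:
  fixes c d :: "('m::finite, 'k::real_normed_field) vseries"
  assumes "c \<in> LC" "d \<in> LC" "superexp v"
  shows "\<exists>w. superexp w \<and> (\<forall>c' d'. (\<lambda>\<eta> i. c' \<eta> i - c \<eta> i) \<in> wball w \<longrightarrow> (\<lambda>\<eta> i. d' \<eta> i - d \<eta> i) \<in> wball w
    \<longrightarrow> (\<lambda>\<eta> i. composition c' d' \<eta> i - composition c d \<eta> i) \<in> wball v)"
proof -
  obtain A p where A: "1 \<le> A" "1 \<le> p" "c \<in> wball (\<lambda>n. A * p ^ n)"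
    using assms(1) in_LC_iff by blast
  obtain B q where B: "1 \<le> B" "1 \<le> q" "d \<in> wball (\<lambda>n. B * q ^ n)"
    using assms(2) in_LC_iff by blast
  \<comment> \<open>The ratio of \<open>norm_composition_diff_right_le\<close> with constant
    \<open>B + 1\<close>, which bounds \<open>d\<close> and \<open>d'\<close> alike because
    \<open>\<delta> \<le> 1\<close>.\<close>
  define L where "L = 8 * real CARD('m option) * p * (B + 1) * q"
  have L: "1 \<le> L"
    unfolding L_def using A B by (intro mult_ge1_I) auto
  \<comment> \<open>The outer change contributes one share and the inner change \<open>A\<close>
    shares; dividing by \<open>1 + A\<close> leaves room for both.\<close>
  have "superexp (\<lambda>n. 1 / (1 + A) * v n)"
    using A by (intro superexp_scale assms) auto
  then obtain s \<delta> where s: "mono s" "\<And>n. 1 \<le> s n" and \<delta>: "0 < \<delta>" "\<delta> \<le> 1"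
    and w: "superexp (\<lambda>n. \<delta> * s n ^ n)" and sv: "\<And>n. \<delta> * (L * s n * s n) ^ n \<le> 1 / (1 + A) * v n"
    using superexp_slow_base[OF _ L] by blast
  have "norm (composition c' d' \<nu> i - composition c d \<nu> i) \<le> v (length \<nu>) * fact (length \<nu>)"
    if c': "(\<lambda>\<eta> i. c' \<eta> i - c \<eta> i) \<in> wball (\<lambda>n. \<delta> * s n ^ n)"
      and d': "(\<lambda>\<eta> i. d' \<eta> i - d \<eta> i) \<in> wball (\<lambda>n. \<delta> * s n ^ n)" for c' d' \<nu> i
  proof -
    let ?n = "length \<nu>"
    \<comment> \<open>Only words up to length \<open>?n\<close> matter, and there the monotone
      \<open>s\<close> is at most \<open>?\<sigma>\<close>: the perturbations have geometric bounds
      with this one ratio.\<close>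
    let ?\<sigma> = "s ?n"
    have \<sigma>: "1 \<le> ?\<sigma>" by (rule s(2))
    \<comment> \<open>The product serves as a common ratio for the original series and for its
      perturbation.\<close>
    have p\<sigma>: "1 \<le> p * ?\<sigma>" "?\<sigma> \<le> p * ?\<sigma>" "p \<le> p * ?\<sigma>"
      using A \<sigma> mult_mono[of 1 p 1 ?\<sigma>] mult_right_mono[of 1 p ?\<sigma>] mult_left_mono[of 1 ?\<sigma> p] by auto
    have q\<sigma>: "1 \<le> q * ?\<sigma>" "?\<sigma> \<le> q * ?\<sigma>" "q \<le> q * ?\<sigma>"
      using B \<sigma> mult_mono[of 1 q 1 ?\<sigma>] mult_right_mono[of 1 q ?\<sigma>] mult_left_mono[of 1 ?\<sigma> q] by auto
    have s_le: "\<delta> * s (length u) ^ length u \<le> \<delta> * ?\<sigma> ^ length u" if "length u \<le> ?n" for u :: "'m option list"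
      using \<delta> s(2)[of "length u"] monoD[OF s(1) that] by (intro mult_left_mono power_mono) auto
    have cc: "norm (c' u j - c u j) \<le> \<delta> * (p * ?\<sigma>) ^ length u * fact (length u)" if "length u \<le> ?n" for u j
    proof -
      have "\<delta> * ?\<sigma> ^ length u \<le> \<delta> * (p * ?\<sigma>) ^ length u"
        using \<delta> \<sigma> p\<sigma> by (intro mult_left_mono power_mono) auto
      then have "\<delta> * s (length u) ^ length u * fact (length u) \<le> \<delta> * (p * ?\<sigma>) ^ length u * fact (length u)"
        using s_le[OF that] by (intro mult_right_mono) auto
      with wballD[OF c', of u j] show ?thesis by linarith
    qed
    have dd0: "norm (d' u j - d u j) \<le> \<delta> * (q * ?\<sigma>) ^ length u * fact (length u)" if "length u \<le> ?n" for u j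
    proof -
      have "\<delta> * ?\<sigma> ^ length u \<le> \<delta> * (q * ?\<sigma>) ^ length u"
        using \<delta> \<sigma> q\<sigma> by (intro mult_left_mono power_mono) auto
      then have "\<delta> * s (length u) ^ length u * fact (length u) \<le> \<delta> * (q * ?\<sigma>) ^ length u * fact (length u)"
        using s_le[OF that] by (intro mult_right_mono) auto
      with wballD[OF d', of u j] show ?thesis by linarith
    qed
    have d0: "norm (d u j) \<le> B * (q * ?\<sigma>) ^ length u * fact (length u)" for u j
    proof -
      have "B * q ^ length u * fact (length u) \<le> B * (q * ?\<sigma>) ^ length u * fact (length u)"
        using B q\<sigma> by (intro mult_right_mono mult_left_mono power_mono) auto
      with wballD[OF B(3), of u j] show ?thesis by linarith
    qed
    have c0: "norm (c u j) \<le> A * (p * ?\<sigma>) ^ length u * fact (length u)" for u j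
    proof -
      have "A * p ^ length u * fact (length u) \<le> A * (p * ?\<sigma>) ^ length u * fact (length u)"
        using A p\<sigma> by (intro mult_right_mono mult_left_mono power_mono) auto
      with wballD[OF A(3), of u j] show ?thesis by linarith
    qed
    have d1: "norm (d u j) \<le> (B + 1) * (q * ?\<sigma>) ^ length u * fact (length u)" for u j
    proof -
      have "B * (q * ?\<sigma>) ^ length u * fact (length u) \<le> (B + 1) * (q * ?\<sigma>) ^ length u * fact (length u)"
        using q\<sigma> by (intro mult_right_mono) auto
      with d0[of u j] show ?thesis by linarith
    qed
    have d'1: "norm (d' u j) \<le> (B + 1) * (q * ?\<sigma>) ^ length u * fact (length u)" if "length u \<le> ?n" for u j
    proof -
      have "\<delta> * (q * ?\<sigma>) ^ length u * fact (length u) \<le> 1 * (q * ?\<sigma>) ^ length u * fact (length u)"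
        using \<delta> q\<sigma> by (intro mult_right_mono) auto
      moreover have "norm (d' u j) \<le> norm (d' u j - d u j) + norm (d u j)"
        using norm_triangle_ineq[of "d' u j - d u j" "d u j"] by simp
      moreover have "(B + 1) * (q * ?\<sigma>) ^ length u * fact (length u)
          = B * (q * ?\<sigma>) ^ length u * fact (length u) + 1 * (q * ?\<sigma>) ^ length u * fact (length u)"
        by (simp only: ring_distribs)
      ultimately show ?thesis
        using dd0[OF that, of j] d0[of u j] by linarith
    qed
    \<comment> \<open>Weakened by the factor \<open>B + 1\<close> to the form
      \<open>\<delta> * C\<close> of the difference estimate.\<close>
    have dd: "norm (d' u j - d u j) \<le> \<delta> * (B + 1) * (q * ?\<sigma>) ^ length u * fact (length u)"
      if "length u \<le> ?n" for u j
    proof -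
      have "\<delta> * 1 * (q * ?\<sigma>) ^ length u * fact (length u) \<le> \<delta> * (B + 1) * (q * ?\<sigma>) ^ length u * fact (length u)"
        using \<delta> B q\<sigma> by (intro mult_right_mono mult_left_mono) auto
      with dd0[OF that, of j] show ?thesis by simp
    qed
    let ?R = "(8 * real CARD('m option) * (p * ?\<sigma>) * (B + 1) * (q * ?\<sigma>)) ^ ?n"
    have R: "?R = (L * ?\<sigma> * ?\<sigma>) ^ ?n"
      by (simp add: L_def mult_ac)
    \<comment> \<open>\<open>composition\<close> is linear in its first argument, so the growth
      bound applies to \<open>c' - c\<close> directly.\<close>
    have 1: "norm (composition c' d' \<nu> i - composition c d' \<nu> i) \<le> \<delta> * ?R * fact ?n"
    proof -
      have "norm (composition c' d' \<nu> i - composition c d' \<nu> i)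
          \<le> \<delta> * (4 * real CARD('m option) * (p * ?\<sigma>) * (B + 1) * (q * ?\<sigma>)) ^ ?n * fact ?n"
        unfolding composition_diff_left
        by (rule norm_composition_le, erule cc, erule d'1) (use B \<delta> p\<sigma>(1) q\<sigma>(1) in simp_all)
      also have "\<dots> \<le> \<delta> * ?R * fact ?n"
        using \<delta> B p\<sigma> q\<sigma> by (intro mult_right_mono mult_left_mono power_mono) auto
      finally show ?thesis .
    qed
    have 2: "norm (composition c d' \<nu> i - composition c d \<nu> i) \<le> A * \<delta> * ?R * fact ?n"
      by (rule norm_composition_diff_right_le, rule c0, rule d1, erule d'1, erule dd) (use A B \<delta> p\<sigma>(1) q\<sigma>(1) in simp_all)
    have "norm (composition c' d' \<nu> i - composition c d \<nu> i)
        \<le> norm (composition c' d' \<nu> i - composition c d' \<nu> i) + norm (composition c d' \<nu> i - composition c d \<nu> i)"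
      using norm_triangle_ineq[of "composition c' d' \<nu> i - composition c d' \<nu> i"
          "composition c d' \<nu> i - composition c d \<nu> i"] by simp
    also have "\<dots> \<le> \<delta> * ?R * fact ?n + A * \<delta> * ?R * fact ?n"
      using 1 2 by (rule add_mono)
    also have "\<dots> = (1 + A) * (\<delta> * (L * ?\<sigma> * ?\<sigma>) ^ ?n) * fact ?n"
      unfolding R by (simp only: ring_distribs mult_ac mult_1_left mult_1_right)
    also have "\<dots> \<le> (1 + A) * (1 / (1 + A) * v ?n) * fact ?n"
      using A by (intro mult_right_mono mult_left_mono sv) auto
    also have "\<dots> = v ?n * fact ?n"
      using A by simp
    finally show ?thesis .
  qed
  then have "(\<lambda>\<eta> i. composition c' d' \<eta> i - composition c d \<eta> i) \<in> wball v"
    if "(\<lambda>\<eta> i. c' \<eta> i - c \<eta> i) \<in> wball (\<lambda>n. \<delta> * s n ^ n)"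
      and "(\<lambda>\<eta> i. d' \<eta> i - d \<eta> i) \<in> wball (\<lambda>n. \<delta> * s n ^ n)" for c' d'
    using that unfolding wball_def[of v] by blast
  with w show ?thesis by blast
qed

text \<open>An arbitrary real normed field covers the real and complex cases at once. Around each
  point of the preimage, a rectangle of open sets with differences in \<open>wball w\<close> is
  mapped into the given open set.\<close>

lemma continuous_map_composition:
  "continuous_map (prod_topology silva_topology silva_topology) silva_topology
     (\<lambda>(c, d). composition c d :: ('m::finite, 'k::real_normed_field) vseries)"
  unfolding continuous_map_def
proof (intro conjI allI impI)
  show "(\<lambda>(c, d). composition c d :: ('m, 'k) vseries)
      \<in> topspace (prod_topology silva_topology silva_topology) \<rightarrow> topspace silva_topology"
    by (auto simp: topspace_silva_topology composition_in_LC)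
  fix S :: "('m, 'k) vseries set" assume S: "openin silva_topology S"
  show "openin (prod_topology silva_topology silva_topology)
      {x \<in> topspace (prod_topology silva_topology silva_topology). (case x of (c, d) \<Rightarrow> composition c d) \<in> S}"
    unfolding openin_prod_topology_alt
  proof (intro allI impI)
    fix c d :: "('m, 'k) vseries"
    assume "(c, d) \<in> {x \<in> topspace (prod_topology silva_topology silva_topology). (case x of (c, d) \<Rightarrow> composition c d) \<in> S}"
    then have cd: "c \<in> LC" "d \<in> LC" "composition c d \<in> S"
      by (auto simp: topspace_silva_topology)
    obtain v where v: "superexp v"
      "\<And>y. y \<in> LC \<Longrightarrow> (\<lambda>\<eta> i. y \<eta> i - composition c d \<eta> i) \<in> wball v \<Longrightarrow> y \<in> S"
      using S cd(3) unfolding openin_silva_topology by blast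
    obtain w where w: "superexp w"
      "\<And>c' d'. (\<lambda>\<eta> i. c' \<eta> i - c \<eta> i) \<in> wball w \<Longrightarrow> (\<lambda>\<eta> i. d' \<eta> i - d \<eta> i) \<in> wball w
        \<Longrightarrow> (\<lambda>\<eta> i. composition c' d' \<eta> i - composition c d \<eta> i) \<in> wball v"
      using composition_diff_in_wball[OF cd(1,2) v(1)] by blast
    obtain U where U: "openin silva_topology U" "c \<in> U" "\<And>y. y \<in> U \<Longrightarrow> (\<lambda>\<eta> i. y \<eta> i - c \<eta> i) \<in> wball w"
      using silva_open_nbhd[OF cd(1) w(1)] by blast
    obtain V where V: "openin silva_topology V" "d \<in> V" "\<And>y. y \<in> V \<Longrightarrow> (\<lambda>\<eta> i. y \<eta> i - d \<eta> i) \<in> wball w"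
      using silva_open_nbhd[OF cd(2) w(1)] by blast
    have "U \<subseteq> LC" "V \<subseteq> LC"
      using U(1) V(1) by (auto simp: openin_silva_topology)
    have "composition c' d' \<in> S" if "c' \<in> U" "d' \<in> V" for c' d'
      by (rule v(2)) (use that \<open>U \<subseteq> LC\<close> \<open>V \<subseteq> LC\<close> U(3) V(3) w(2) composition_in_LC in blast)+
    with \<open>U \<subseteq> LC\<close> \<open>V \<subseteq> LC\<close>
    have "U \<times> V \<subseteq> {x \<in> topspace (prod_topology silva_topology silva_topology). (case x of (c, d) \<Rightarrow> composition c d) \<in> S}"
      by (auto simp: topspace_silva_topology)
    with U V show "\<exists>U V. openin silva_topology U \<and> openin silva_topology V \<and> c \<in> U \<and> d \<in> V \<and>
        U \<times> V \<subseteq> {x \<in> topspace (prod_topology silva_topology silva_topology). (case x of (c, d) \<Rightarrow> composition c d) \<in> S}"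
      by blast
  qed
qed

theorem theorem3p8:
  shows "continuous_map (prod_topology silva_topology silva_topology) silva_topology
           (\<lambda>(c, d). composition c d :: ('m::finite, real) vseries)
       \<and> continuous_map (prod_topology silva_topology silva_topology) silva_topology
           (\<lambda>(c, d). composition c d :: ('m::finite, complex) vseries)"
  by (intro conjI continuous_map_composition)

end
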